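(* In the two-server system, suppose $\delta\le\epsilon<\frac12$, $\beta\ge2\delta$, and CARD's work threshold is $c=\frac{2m_+}{\beta}\log\frac{3}{2\beta\delta}$ (with $c\ge m_+$). Then \[ \mathbb E[T_{\mathrm{CARD}}]\le\Big(K_{\mathrm{CARD}}+\frac{4\beta}{\alpha+\beta}\Big)\Big(1+\frac{\delta}{\epsilon}\Big)\mathbb E[W_{\mathrm{M/G/1}}]+2\mathbb E[S] +44m_+\max\Big\{\frac{\beta}{\alpha^2(\alpha+\beta)},\ \sqrt{\frac{\beta}{\alpha^2\epsilon(\alpha+\beta)}},\ \frac{\log\frac{3}{2\beta\delta}}{\beta(\alpha+\beta)},\ \sqrt{\frac{\log\frac{3}{2\beta\delta}}{\beta}},\ \frac{\sqrt\delta\,\log\frac{3}{2\beta\delta}}{\alpha^2\beta^2\epsilon}\Big\}. \]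
   Context: Two-server model: servers $1$ (short, work $W_s$) and $2$ (long, work $W_\ell$), each with its own FCFS queue, each completing work at rate $1/2$ while nonempty. Poisson arrivals of rate $\lambda$, i.i.d. job sizes $S$ with continuous distribution and $\mathbb E[S^2]<\infty$; a job of size $s$ sent to a server with work $w$ has response time $2(w+s)$; $\mathbb E[T_{\mathrm{CARD}}]$ is the mean response time under CARD. $\rho=\lambda\mathbb E[S]$, $\epsilon=1-\rho$. CARD with parameters $0\le m_-\le m_+\le c$: jobs of size $<m_-$ go to the short server; jobs of size in $[m_-,m_+)$ go to the short server if $W_s\le c$ at arrival and to the long server otherwise; jobs of size $\ge m_+$ go to the long server. $\rho_s=\lambda\mathbb E[S\mathbf 1(S<m_-)]$, $\rho_m=\lambda\mathbb E[S\mathbf 1(m_-\le S<m_+)]$, $\alpha=\frac12-\rho_s>0$, $\beta=\rho_s+\rho_m-\frac12>0$; $\delta>0$. $\mathbb E[W_{\mathrm{M/G/1}}]=\frac{\lambda\mathbb E[S^2]}{2\epsilon}$. The number $m$ solves $\mathbb E[S\mathbf 1(S<m)]=\frac12\mathbb E[S]$, and $K_{\mathrm{CARD}}=2\mathbb P(S\ge m)$. *)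

theory Defs
  imports "HOL-Probability.Probability"
begin

text \<open>Sample-path model of the two-server system under CARD.
  Job n arrives (job 0 at time 0 into an empty system); x n is the interarrival
  time between job n and job n+1, s n is the size of job n.
  card_state ... n = (W_s, W_l) seen by job n at its arrival.\<close>

definition card_to_short :: "real \<Rightarrow> real \<Rightarrow> real \<Rightarrow> real \<Rightarrow> real \<Rightarrow> bool" where
  "card_to_short m_minus m_plus c ws sz \<longleftrightarrow>
     sz < m_minus \<or> (m_minus \<le> sz \<and> sz < m_plus \<and> ws \<le> c)"

primrec card_state :: "real \<Rightarrow> real \<Rightarrow> real \<Rightarrow> (nat \<Rightarrow> real) \<Rightarrow> (nat \<Rightarrow> real) \<Rightarrow> nat \<Rightarrow> real \<times> real" where
  "card_state m_minus m_plus c x s 0 = (0, 0)"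
| "card_state m_minus m_plus c x s (Suc n) =
     (let (ws, wl) = card_state m_minus m_plus c x s n;
          short = card_to_short m_minus m_plus c ws (s n);
          ws' = ws + (if short then s n else 0);
          wl' = wl + (if short then 0 else s n)
      in (max 0 (ws' - x n / 2), max 0 (wl' - x n / 2)))"

definition card_resp :: "real \<Rightarrow> real \<Rightarrow> real \<Rightarrow> (nat \<Rightarrow> real) \<Rightarrow> (nat \<Rightarrow> real) \<Rightarrow> nat \<Rightarrow> real" where
  "card_resp m_minus m_plus c x s n =
     (let (ws, wl) = card_state m_minus m_plus c x s n
      in if card_to_short m_minus m_plus c ws (s n) then 2 * (ws + s n) else 2 * (wl + s n))"

text \<open>Mean response time E[T_CARD], taken as the limsup of the Cesaro averages of the
  expected response times of the first N jobs (ennreal-valued, so no integrability side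
  conditions are hidden).\<close>
definition mean_resp_CARD ::
  "'a measure \<Rightarrow> (nat \<Rightarrow> 'a \<Rightarrow> real) \<Rightarrow> (nat \<Rightarrow> 'a \<Rightarrow> real) \<Rightarrow> real \<Rightarrow> real \<Rightarrow> real \<Rightarrow> ennreal" where
  "mean_resp_CARD M X Sz m_minus m_plus c =
     limsup (\<lambda>N. (\<Sum>n<N. \<integral>\<^sup>+ \<omega>. ennreal (card_resp m_minus m_plus c (\<lambda>k. X k \<omega>) (\<lambda>k. Sz k \<omega>) n) \<partial>M)
                   / of_nat N)"

end

theory Submission
  imports Defs
begin

text \<open>Write \<open>a, b\<close> for the short and long work, \<open>W = a + b\<close>, \<open>u = max 0 (a - c)\<close>. The short work is an
  autonomous chain with drift \<open>\<beta>\<close> below \<open>c\<close> and \<open>-\<alpha>\<close> above. One Lyapunov function \<open>G\<close>, a positive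
  combination of \<open>a\<close>, \<open>u\<^sup>2 - m_plus u\<close>, \<open>u\<^sup>3 - m_plus\<^sup>2 u\<close>, \<open>exp (- \<theta> a)\<close>, \<open>exp (- \<theta> a) b\<close>, \<open>a W\<close>, \<open>W\<^sup>2\<close>
  and \<open>- W\<close>, satisfies \<open>cost + drift G \<le> B\<close> pointwise. Since \<open>G\<close> is bounded below, telescoping
  bounds the Cesaro means of the cost by \<open>B + O(1/N)\<close> without any stationarity.

  The term \<open>W\<^sup>2\<close> yields the M/G/1 work; \<open>a W\<close> decorrelates \<open>b\<close> from \<open>1(a > c)\<close>, which has frequency
  about \<open>\<beta> / (\<alpha> + \<beta>)\<close>; \<open>exp (- \<theta> a) b\<close> with \<open>\<theta> = \<beta> / m_plus\<close> pays for the long work present while the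
  short server idles, at the price of a factor \<open>exp (- \<theta> c) = (2 \<beta> \<delta> / 3)\<^sup>2\<close>; \<open>- W\<close> pays for the idleness
  of the long server, which has frequency at most \<open>2 \<epsilon>\<close>; and the powers of \<open>u\<close>, with linear corrections
  that absorb the jumps across \<open>c\<close>, control the overshoot above \<open>c\<close>. Only the first three terms of the
  maximum are needed.\<close>

section \<open>Service over an exponential interarrival time\<close>

text \<open>The obstacle: the drift of \<open>W^2\<close> contains the lost-service terms
  \<open>b * 1(a = 0)\<close> and \<open>a * 1(b = 0)\<close>, and \<open>W^2\<close> carries a
  coefficient of order \<open>1 / \<epsilon>\<close>, so every bound on them is amplified. The first
  is traded for \<open>b * 1(c < a)\<close> times \<open>exp (- \<theta> * c)\<close>, small enough
  to be returned to the term linear in \<open>W\<close>. For the second,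
  \<open>a \<le> c + u\<close>: the part \<open>c\<close> meets an idle frequency of order
  \<open>\<epsilon>\<close>, which cancels \<open>1 / \<epsilon>\<close>; the part \<open>u\<close>
  is split by Young's inequality into more idle frequency and a \<open>u^2\<close> that the cubic
  term pays. Balancing these two gives the second entry of the maximum. The waiting cost is at most
  \<open>2 a + K b + 2 b 1(c < a)\<close>. Adding the drift of
  \<open>2 / (\<alpha> + \<beta>) * a * W\<close> replaces its last term by
  \<open>2 \<beta> / (\<alpha> + \<beta>) * W\<close> and caps \<open>2 a\<close> by
  \<open>2 c\<close>. The other half of the theorem's
  \<open>4 \<beta> / (\<alpha> + \<beta>)\<close>, and the factor
  \<open>1 + \<delta> / \<epsilon>\<close>, are slack that absorbs the
  \<open>exp (- \<theta> * c)\<close> errors.\<close>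

lemma exponential_service_identity:
  fixes h k :: "real \<Rightarrow> real"
  assumes lam: "0 < lam" and cont: "continuous_on {0..} h" and F: "finite F"
    and deriv: "\<And>t. 0 < t \<Longrightarrow> t \<notin> F \<Longrightarrow> (h has_real_derivative - k t) (at t)"
    and meas [measurable]: "h \<in> borel_measurable borel" "k \<in> borel_measurable borel"
    and bound: "\<And>t. 0 \<le> t \<Longrightarrow> \<bar>h t\<bar> \<le> C" "\<And>t. 0 \<le> t \<Longrightarrow> \<bar>k t\<bar> \<le> C"
    and const: "\<And>t. T \<le> t \<Longrightarrow> h t = h T" "\<And>t. T \<le> t \<Longrightarrow> k t = 0" and T: "0 \<le> T"
  shows "(\<integral>t. h t + k t / lam \<partial>density lborel (exponential_density lam)) = h 0"
proof -
  let ?E = "density lborel (exponential_density lam)"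
  interpret E: prob_space ?E using prob_space_exponential_density[OF lam] .
  \<comment> \<open>\<open>F'\<close> is the derivative of
    \<open>- exp (- lam * t) * (h t - h T)\<close>. Subtracting the terminal value makes the
    integrand vanish beyond \<open>T\<close>, so the fundamental theorem is applied on
    \<open>{0..T}\<close> only, with the finitely many kinks in \<open>F\<close> as exceptional
    points.\<close>
  define F' where "F' t = lam * exp (- lam * t) * (h t - h T) + exp (- lam * t) * k t" for t
  have bd: "\<bar>h T\<bar> \<le> C" using bound(1)[OF T] .
  have C0: "0 \<le> C" using bd by linarith
  have AEpos: "AE t in ?E. 0 \<le> t"
    by (subst AE_density) (auto simp: exponential_density_def)
  have intE: "integrable ?E (\<lambda>t. h t - h T + k t / lam)"
  proof (rule E.integrable_const_bound[where B = "2 * C + C / lam"])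
    show "AE t in ?E. norm (h t - h T + k t / lam) \<le> 2 * C + C / lam"
      using AEpos
    proof eventually_elim
      case (elim t)
      have "\<bar>k t / lam\<bar> \<le> C / lam" using bound(2)[OF elim] lam by (simp add: divide_right_mono)
      then show ?case using bound(1)[OF elim] bd unfolding real_norm_def abs_le_iff by linarith
    qed
  qed simp
  have FTC: "(F' has_integral (- exp (- lam * T) * (h T - h T)) - (- exp (- lam * 0) * (h 0 - h T))) {0..T}"
  proof (rule fundamental_theorem_of_calculus_interior_strong[OF F T])
    show "continuous_on {0..T} (\<lambda>t. - exp (- lam * t) * (h t - h T))"
      by (intro continuous_intros continuous_on_subset[OF cont]) auto
    fix t assume t: "t \<in> {0<..<T} - F"
    show "((\<lambda>t. - exp (- lam * t) * (h t - h T)) has_vector_derivative F' t) (at t)"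
      unfolding has_real_derivative_iff_has_vector_derivative[symmetric] F'_def
      using t by (auto intro!: derivative_eq_intros deriv simp: algebra_simps)
  qed
  have si: "set_integrable lborel {0..T} F'"
    unfolding set_integrable_def
  proof (rule integrableI_bounded_set_indicator[where B = "lam * (2 * C) + C"])
    show "AE t in lborel. t \<in> {0..T} \<longrightarrow> norm (F' t) \<le> lam * (2 * C) + C"
    proof (rule AE_I2, rule impI)
      fix t assume t: "t \<in> {0..T}"
      have e: "exp (- lam * t) \<le> 1" using t lam by simp
      have "\<bar>h t - h T\<bar> \<le> 2 * C" using bound(1)[of t] bd t by (simp add: abs_le_iff)
      then have "exp (- lam * t) * \<bar>h t - h T\<bar> \<le> 1 * (2 * C)" by (intro mult_mono e) auto
      moreover have "exp (- lam * t) * \<bar>k t\<bar> \<le> 1 * C"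
        using bound(2)[of t] t by (intro mult_mono e) auto
      ultimately have "lam * (exp (- lam * t) * \<bar>h t - h T\<bar>) + exp (- lam * t) * \<bar>k t\<bar> \<le> lam * (2 * C) + C"
        using lam by (intro add_mono mult_left_mono) auto
      moreover have "norm (F' t) \<le> lam * (exp (- lam * t) * \<bar>h t - h T\<bar>) + exp (- lam * t) * \<bar>k t\<bar>"
        unfolding F'_def real_norm_def
        by (rule order_trans[OF abs_triangle_ineq]) (use lam in \<open>simp add: abs_mult mult.assoc\<close>)
      ultimately show "norm (F' t) \<le> lam * (2 * C) + C" by linarith
    qed
  qed (auto simp: F'_def emeasure_lborel_Icc_eq)
  have "(\<integral>t. h t - h T + k t / lam \<partial>?E)
      = (\<integral>t. exponential_density lam t *\<^sub>R (h t - h T + k t / lam) \<partial>lborel)"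
    by (subst integral_density) (use lam in \<open>auto simp: exponential_density_def\<close>)
  also have "\<dots> = (LINT t:{0..T}|lborel. F' t)"
    unfolding set_lebesgue_integral_def
  proof (rule Bochner_Integration.integral_cong[OF refl])
    fix t
    have F': "lam * exp (- (t * lam)) * (h t - h T + k t / lam) = F' t"
      unfolding F'_def using lam by (simp add: field_simps)
    consider "t < 0" | "0 \<le> t" "t \<le> T" | "0 \<le> t" "T < t" by linarith
    then show "exponential_density lam t *\<^sub>R (h t - h T + k t / lam) = indicator {0..T} t *\<^sub>R F' t"
    proof cases
      case 3
      then show ?thesis using const(1)[of t] const(2)[of t] by simp
    qed (use F' in \<open>simp_all add: exponential_density_def\<close>)
  qed
  also have "\<dots> = integral {0..T} F'"
    by (rule set_borel_integral_eq_integral(2)[OF si])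
  also have "\<dots> = h 0 - h T" using FTC by (simp add: integral_unique)
  finally have eq: "(\<integral>t. h t - h T + k t / lam \<partial>?E) = h 0 - h T" .
  have "(\<integral>t. h t + k t / lam \<partial>?E) = (\<integral>t. (h t - h T + k t / lam) + h T \<partial>?E)"
    by (simp add: algebra_simps)
  also have "\<dots> = h 0 - h T + h T"
    using intE E.prob_space by (subst Bochner_Integration.integral_add) (auto simp: eq)
  finally show ?thesis by simp
qed

section \<open>Test functions and their derivatives along the service path\<close>

lemma served_deriv:
  fixes p :: "real \<Rightarrow> real"
  assumes deriv: "\<And>t. 0 < t \<Longrightarrow> t \<notin> F \<Longrightarrow> (p has_real_derivative p' t) (at t)"
    and t: "t \<noteq> 2 * a" "a - t / 2 \<notin> F"
  shows "((\<lambda>t. p (max 0 (a - t / 2))) has_real_derivative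
           - (of_bool (0 < max 0 (a - t / 2)) * p' (max 0 (a - t / 2)) / 2)) (at t)"
proof (cases "t < 2 * a")
  case True
  have "((\<lambda>t. p (a - t / 2)) has_real_derivative p' (a - t / 2) * (- (1 / 2))) (at t)"
    by (rule DERIV_chain2[OF deriv]) (use True t in \<open>auto intro!: derivative_eq_intros\<close>)
  then have "((\<lambda>t. p (max 0 (a - t / 2))) has_real_derivative p' (a - t / 2) * (- (1 / 2))) (at t)"
    by (rule has_field_derivative_transform_within_open[where S = "{..<2 * a}"]) (use True in auto)
  then show ?thesis using True by simp
next
  case False
  have "((\<lambda>_. p 0) has_real_derivative 0) (at t)" by simp
  then have "((\<lambda>t. p (max 0 (a - t / 2))) has_real_derivative 0) (at t)"
    by (rule has_field_derivative_transform_within_open[where S = "{2 * a<..}"]) (use False t in auto)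
  then show ?thesis using False t by simp
qed

text \<open>Here \<open>dg\<close> is minus the derivative of \<open>g\<close> along the service path
  \<open>t \<mapsto> (max 0 (a - t/2), max 0 (b - t/2))\<close>. Integrating by parts against the exponential
  gap shows that the mean of \<open>g + dg / lam\<close> at the next arrival is \<open>g\<close> at the post-jump state,
  so the chain seen by arrivals satisfies the drift identities of the continuous-time generator.\<close>

definition service_pair :: "real \<Rightarrow> (real \<Rightarrow> real \<Rightarrow> real) \<Rightarrow> (real \<Rightarrow> real \<Rightarrow> real) \<Rightarrow> bool" where
  "service_pair lam g dg \<longleftrightarrow>
     (\<lambda>(a, b). g a b) \<in> borel_measurable borel \<and> (\<lambda>(a, b). dg a b) \<in> borel_measurable borel \<and>
     (\<forall>A. \<exists>C. \<forall>a b. 0 \<le> a \<longrightarrow> a \<le> A \<longrightarrow> 0 \<le> b \<longrightarrow>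
        \<bar>g a b\<bar> \<le> C * (1 + b\<^sup>2) \<and> \<bar>dg a b\<bar> \<le> C * (1 + b\<^sup>2)) \<and>
     (\<forall>a b. 0 \<le> a \<longrightarrow> 0 \<le> b \<longrightarrow>
        (\<integral>t. g (max 0 (a - t / 2)) (max 0 (b - t / 2)) + dg (max 0 (a - t / 2)) (max 0 (b - t / 2)) / lam
           \<partial>density lborel (exponential_density lam)) = g a b)"

lemma service_pair_bound:
  assumes "service_pair lam g dg"
  obtains C where "0 \<le> C"
    "\<And>a b. 0 \<le> a \<Longrightarrow> a \<le> A \<Longrightarrow> 0 \<le> b \<Longrightarrow> \<bar>g a b\<bar> \<le> C * (1 + b\<^sup>2) \<and> \<bar>dg a b\<bar> \<le> C * (1 + b\<^sup>2)"
proof -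
  obtain C where C: "\<forall>a b. 0 \<le> a \<longrightarrow> a \<le> A \<longrightarrow> 0 \<le> b \<longrightarrow>
        \<bar>g a b\<bar> \<le> C * (1 + b\<^sup>2) \<and> \<bar>dg a b\<bar> \<le> C * (1 + b\<^sup>2)"
    using assms unfolding service_pair_def by blast
  show ?thesis
  proof (rule that[of "\<bar>C\<bar>"])
    fix a b :: real assume "0 \<le> a" "a \<le> A" "0 \<le> b"
    then have "\<bar>g a b\<bar> \<le> C * (1 + b\<^sup>2) \<and> \<bar>dg a b\<bar> \<le> C * (1 + b\<^sup>2)" using C by blast
    moreover have "C * (1 + b\<^sup>2) \<le> \<bar>C\<bar> * (1 + b\<^sup>2)" by (intro mult_right_mono) auto
    ultimately show "\<bar>g a b\<bar> \<le> \<bar>C\<bar> * (1 + b\<^sup>2) \<and> \<bar>dg a b\<bar> \<le> \<bar>C\<bar> * (1 + b\<^sup>2)" by linarith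
  qed simp
qed

lemma service_pair_measurable:
  assumes "service_pair lam g dg"
  shows "(\<lambda>w. g (fst w) (snd w)) \<in> borel_measurable (borel \<Otimes>\<^sub>M borel)"
    "(\<lambda>w. dg (fst w) (snd w)) \<in> borel_measurable (borel \<Otimes>\<^sub>M borel)"
  using assms by (simp_all add: service_pair_def borel_prod split_beta')

lemma service_pair_integral:
  assumes "service_pair lam g dg" "0 \<le> a" "0 \<le> b"
  shows "(\<integral>t. g (max 0 (a - t / 2)) (max 0 (b - t / 2)) + dg (max 0 (a - t / 2)) (max 0 (b - t / 2)) / lam
           \<partial>density lborel (exponential_density lam)) = g a b"
  using assms unfolding service_pair_def by blast

text \<open>The identity in \<open>service_pair\<close> concerns the Bochner integral, which is 0 by
  default on non-integrable functions, so integrability has to come from the growth clause. Both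
  workloads only decrease during service, so the bound at the starting point serves for the whole
  path.\<close>

lemma service_pair_integrable:
  assumes sp: "service_pair lam g dg" and lam: "0 < lam" and ab: "0 \<le> a" "0 \<le> b"
  shows "integrable (density lborel (exponential_density lam))
    (\<lambda>t. g (max 0 (a - t / 2)) (max 0 (b - t / 2)) + dg (max 0 (a - t / 2)) (max 0 (b - t / 2)) / lam)"
proof -
  let ?E = "density lborel (exponential_density lam)"
  interpret E: prob_space ?E using prob_space_exponential_density[OF lam] .
  note [measurable] = service_pair_measurable[OF sp]
  obtain C where C: "0 \<le> C" "\<And>a' b. 0 \<le> a' \<Longrightarrow> a' \<le> a \<Longrightarrow> 0 \<le> b \<Longrightarrow>
      \<bar>g a' b\<bar> \<le> C * (1 + b\<^sup>2) \<and> \<bar>dg a' b\<bar> \<le> C * (1 + b\<^sup>2)"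
    using service_pair_bound[OF sp, of a] by blast
  have m1: "(\<lambda>t. (max 0 (a - t / 2), max 0 (b - t / 2))) \<in> borel \<rightarrow>\<^sub>M borel \<Otimes>\<^sub>M borel" by measurable
  note m2 = measurable_compose[OF m1 service_pair_measurable(1)[OF sp]]
    measurable_compose[OF m1 service_pair_measurable(2)[OF sp]]
  show ?thesis
  proof (rule E.integrable_const_bound[where B = "C * (1 + b\<^sup>2) + C * (1 + b\<^sup>2) / lam"])
    show "AE t in ?E. norm (g (max 0 (a - t / 2)) (max 0 (b - t / 2))
        + dg (max 0 (a - t / 2)) (max 0 (b - t / 2)) / lam) \<le> C * (1 + b\<^sup>2) + C * (1 + b\<^sup>2) / lam"
    proof (subst AE_density, simp, rule AE_I2, rule impI)
      fix t :: real assume "0 < ennreal (exponential_density lam t)"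
      then have t: "0 \<le> t" by (auto simp: exponential_density_def split: if_splits)
      let ?a = "max 0 (a - t / 2)" and ?b = "max 0 (b - t / 2)"
      have "?b\<^sup>2 \<le> b\<^sup>2" using t ab by (intro power_mono) auto
      then have le: "C * (1 + ?b\<^sup>2) \<le> C * (1 + b\<^sup>2)" using C(1) by (intro mult_left_mono) auto
      have "\<bar>g ?a ?b\<bar> \<le> C * (1 + ?b\<^sup>2) \<and> \<bar>dg ?a ?b\<bar> \<le> C * (1 + ?b\<^sup>2)"
        using t ab by (intro C(2)) auto
      then have "\<bar>g ?a ?b\<bar> \<le> C * (1 + b\<^sup>2)" "\<bar>dg ?a ?b / lam\<bar> \<le> C * (1 + b\<^sup>2) / lam"
        using le lam by (auto intro!: divide_right_mono)
      then show "norm (g ?a ?b + dg ?a ?b / lam) \<le> C * (1 + b\<^sup>2) + C * (1 + b\<^sup>2) / lam"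
        by (simp only: real_norm_def abs_le_iff) linarith
    qed
  qed (use m2 in simp)
qed

lemma service_pair_lincomb:
  assumes 1: "service_pair lam g1 d1" and 2: "service_pair lam g2 d2" and lam: "0 < lam"
  shows "service_pair lam (\<lambda>a b. x * g1 a b + y * g2 a b) (\<lambda>a b. x * d1 a b + y * d2 a b)"
  unfolding service_pair_def
proof (intro conjI allI impI)
  note m[measurable] = service_pair_measurable[OF 1] service_pair_measurable[OF 2]
  show "(\<lambda>(a, b). x * g1 a b + y * g2 a b) \<in> borel_measurable borel"
    "(\<lambda>(a, b). x * d1 a b + y * d2 a b) \<in> borel_measurable borel"
    unfolding split_beta' borel_prod[symmetric] by measurable
  fix A
  obtain C1 where C1: "0 \<le> C1" "\<And>a b. 0 \<le> a \<Longrightarrow> a \<le> A \<Longrightarrow> 0 \<le> b \<Longrightarrow>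
      \<bar>g1 a b\<bar> \<le> C1 * (1 + b\<^sup>2) \<and> \<bar>d1 a b\<bar> \<le> C1 * (1 + b\<^sup>2)"
    using service_pair_bound[OF 1, of A] by blast
  obtain C2 where C2: "0 \<le> C2" "\<And>a b. 0 \<le> a \<Longrightarrow> a \<le> A \<Longrightarrow> 0 \<le> b \<Longrightarrow>
      \<bar>g2 a b\<bar> \<le> C2 * (1 + b\<^sup>2) \<and> \<bar>d2 a b\<bar> \<le> C2 * (1 + b\<^sup>2)"
    using service_pair_bound[OF 2, of A] by blast
  have comb: "\<bar>x * u + y * v\<bar> \<le> (\<bar>x\<bar> * C1 + \<bar>y\<bar> * C2) * (1 + b\<^sup>2)"
    if "\<bar>u\<bar> \<le> C1 * (1 + b\<^sup>2)" "\<bar>v\<bar> \<le> C2 * (1 + b\<^sup>2)" for u v b :: real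
  proof -
    have "\<bar>x * u + y * v\<bar> \<le> \<bar>x\<bar> * \<bar>u\<bar> + \<bar>y\<bar> * \<bar>v\<bar>"
      by (rule order_trans[OF abs_triangle_ineq]) (simp add: abs_mult)
    also have "\<dots> \<le> \<bar>x\<bar> * (C1 * (1 + b\<^sup>2)) + \<bar>y\<bar> * (C2 * (1 + b\<^sup>2))"
      using that by (intro add_mono mult_left_mono) auto
    finally show ?thesis by (simp add: algebra_simps)
  qed
  show "\<exists>C. \<forall>a b. 0 \<le> a \<longrightarrow> a \<le> A \<longrightarrow> 0 \<le> b \<longrightarrow>
      \<bar>x * g1 a b + y * g2 a b\<bar> \<le> C * (1 + b\<^sup>2) \<and> \<bar>x * d1 a b + y * d2 a b\<bar> \<le> C * (1 + b\<^sup>2)"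
    by (intro exI[of _ "\<bar>x\<bar> * C1 + \<bar>y\<bar> * C2"]) (auto intro!: comb C1 C2 simp: C1(2) C2(2))
next
  fix a b :: real assume ab: "0 \<le> a" "0 \<le> b"
  let ?E = "density lborel (exponential_density lam)"
  let ?a = "\<lambda>t. max 0 (a - t / 2)" and ?b = "\<lambda>t. max 0 (b - t / 2)"
  have "(\<integral>t. x * g1 (?a t) (?b t) + y * g2 (?a t) (?b t)
         + (x * d1 (?a t) (?b t) + y * d2 (?a t) (?b t)) / lam \<partial>?E)
      = (\<integral>t. x * (g1 (?a t) (?b t) + d1 (?a t) (?b t) / lam)
           + y * (g2 (?a t) (?b t) + d2 (?a t) (?b t) / lam) \<partial>?E)"
    by (rule Bochner_Integration.integral_cong) (simp_all add: add_divide_distrib algebra_simps)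
  also have "\<dots> = x * g1 a b + y * g2 a b"
    using service_pair_integrable[OF 1 lam ab] service_pair_integrable[OF 2 lam ab]
    by (simp add: service_pair_integral[OF 1 ab] service_pair_integral[OF 2 ab])
  finally show "(\<integral>t. x * g1 (?a t) (?b t) + y * g2 (?a t) (?b t)
         + (x * d1 (?a t) (?b t) + y * d2 (?a t) (?b t)) / lam \<partial>?E) = x * g1 a b + y * g2 a b" .
qed

text \<open>All Lyapunov components are combinations of such products. The growth condition is
  quadratic in \<open>b\<close> but only local in \<open>a\<close>: sizes routed to the long server
  have just two moments, whereas a job sent to the short server is smaller than
  \<open>m_plus\<close>, so \<open>a\<close> stays bounded over finitely many arrivals. This is what
  admits the cube of the excess.\<close>

lemma service_pair_power:
  fixes p p' :: "real \<Rightarrow> real"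
  assumes lam: "0 < lam" and cont: "continuous_on {0..} p" and F: "finite F"
    and deriv: "\<And>t. 0 < t \<Longrightarrow> t \<notin> F \<Longrightarrow> (p has_real_derivative p' t) (at t)"
    and pm[measurable]: "p \<in> borel_measurable borel" "p' \<in> borel_measurable borel"
    and bound: "\<And>A. \<exists>C. \<forall>t. 0 \<le> t \<longrightarrow> t \<le> A \<longrightarrow> \<bar>p' t\<bar> \<le> C"
    and j: "j \<le> 2"
  shows "service_pair lam (\<lambda>a b. p a * b ^ j)
     (\<lambda>a b. (of_bool (0 < a) * p' a * b ^ j + of_bool (0 < b) * p a * (real j * b ^ (j - 1))) / 2)"
    (is "service_pair lam ?g ?d")
proof -
  have pow1: "b ^ j \<le> 1 + b\<^sup>2" if "0 \<le> b" for b :: real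
  proof -
    have "b \<le> 1 + b\<^sup>2" using sum_squares_bound[of 1 b] that by simp
    then show ?thesis using j that by (auto simp: le_Suc_eq numeral_2_eq_2)
  qed
  have pow2: "real j * b ^ (j - 1) \<le> 2 * (1 + b\<^sup>2)" if "0 \<le> b" for b :: real
  proof -
    have "b \<le> 1 + b\<^sup>2" using sum_squares_bound[of 1 b] that by simp
    then show ?thesis using j that by (auto simp: le_Suc_eq numeral_2_eq_2)
  qed
  have growth: "\<exists>C. \<forall>a b. 0 \<le> a \<longrightarrow> a \<le> A \<longrightarrow> 0 \<le> b \<longrightarrow>
      \<bar>?g a b\<bar> \<le> C * (1 + b\<^sup>2) \<and> \<bar>?d a b\<bar> \<le> C * (1 + b\<^sup>2)" for A
  proof -
    have "compact (p ` {0..A})"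
      by (intro compact_continuous_image continuous_on_subset[OF cont]) auto
    then obtain C1 where C1: "\<And>t. t \<in> {0..A} \<Longrightarrow> \<bar>p t\<bar> \<le> C1"
      using compact_imp_bounded[of "p ` {0..A}"] unfolding bounded_iff
      by (metis image_eqI real_norm_def)
    obtain C2 where C2: "\<And>t. 0 \<le> t \<Longrightarrow> t \<le> A \<Longrightarrow> \<bar>p' t\<bar> \<le> C2" using bound by blast
    have "\<bar>?g a b\<bar> \<le> (\<bar>C1\<bar> + \<bar>C2\<bar>) * (1 + b\<^sup>2) \<and> \<bar>?d a b\<bar> \<le> (\<bar>C1\<bar> + \<bar>C2\<bar>) * (1 + b\<^sup>2)"
      if ab: "0 \<le> a" "a \<le> A" "0 \<le> b" for a b
    proof -
      have p: "\<bar>p a\<bar> \<le> \<bar>C1\<bar>" "\<bar>p' a\<bar> \<le> \<bar>C2\<bar>" using C1[of a] C2[of a] ab by auto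
      have b0: "0 \<le> b ^ j" "0 \<le> real j * b ^ (j - 1)" using ab by auto
      have g: "\<bar>p a\<bar> * b ^ j \<le> \<bar>C1\<bar> * (1 + b\<^sup>2)"
        using p pow1[OF ab(3)] b0 by (intro mult_mono) auto
      have 1: "of_bool (0 < a) * \<bar>p' a\<bar> * b ^ j \<le> \<bar>C2\<bar> * (1 + b\<^sup>2)"
        using p pow1[OF ab(3)] b0 by (intro mult_mono) auto
      have 2: "of_bool (0 < b) * \<bar>p a\<bar> * (real j * b ^ (j - 1)) \<le> \<bar>C1\<bar> * (2 * (1 + b\<^sup>2))"
        by (rule mult_mono[OF _ pow2[OF ab(3)]]) (use p b0 in \<open>auto simp: of_bool_def\<close>)
      have "\<bar>?d a b\<bar> \<le> (of_bool (0 < a) * \<bar>p' a\<bar> * b ^ j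
           + of_bool (0 < b) * \<bar>p a\<bar> * (real j * b ^ (j - 1))) / 2"
        using abs_triangle_ineq[of "of_bool (0 < a) * p' a * b ^ j" "of_bool (0 < b) * p a * (real j * b ^ (j - 1))"]
          b0 zero_le_power[OF ab(3), of "j - 1"] by (simp add: abs_mult)
      also have "\<dots> \<le> (\<bar>C2\<bar> * (1 + b\<^sup>2) + \<bar>C1\<bar> * (2 * (1 + b\<^sup>2))) / 2"
        using 1 2 by (intro divide_right_mono) auto
      also have "\<dots> \<le> (\<bar>C1\<bar> + \<bar>C2\<bar>) * (1 + b\<^sup>2)" by (simp add: field_simps)
      finally have d: "\<bar>?d a b\<bar> \<le> (\<bar>C1\<bar> + \<bar>C2\<bar>) * (1 + b\<^sup>2)" .
      have "\<bar>?g a b\<bar> \<le> \<bar>C1\<bar> * (1 + b\<^sup>2)" using g b0 by (simp add: abs_mult)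
      also have "\<dots> \<le> (\<bar>C1\<bar> + \<bar>C2\<bar>) * (1 + b\<^sup>2)" by (intro mult_right_mono) auto
      finally show ?thesis using d by blast
    qed
    then show ?thesis by blast
  qed
  show ?thesis
    unfolding service_pair_def
  proof (intro conjI allI impI growth)
    show "(\<lambda>(a, b). ?g a b) \<in> borel_measurable borel" "(\<lambda>(a, b). ?d a b) \<in> borel_measurable borel"
      unfolding split_beta' borel_prod[symmetric] by measurable
  next
    fix a b :: real assume ab: "0 \<le> a" "0 \<le> b"
    let ?a = "\<lambda>t. max 0 (a - t / 2)" and ?b = "\<lambda>t. max 0 (b - t / 2)"
    obtain C where C: "\<forall>a' b. 0 \<le> a' \<longrightarrow> a' \<le> a \<longrightarrow> 0 \<le> b \<longrightarrow>
      \<bar>?g a' b\<bar> \<le> C * (1 + b\<^sup>2) \<and> \<bar>?d a' b\<bar> \<le> C * (1 + b\<^sup>2)"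
      using growth[of a] by blast
    have bnd: "\<bar>?g (?a t) (?b t)\<bar> \<le> \<bar>C\<bar> * (1 + b\<^sup>2) \<and> \<bar>?d (?a t) (?b t)\<bar> \<le> \<bar>C\<bar> * (1 + b\<^sup>2)"
      if "0 \<le> t" for t
    proof -
      have "C * (1 + (?b t)\<^sup>2) \<le> \<bar>C\<bar> * (1 + b\<^sup>2)"
        using that ab by (intro mult_mono add_mono power_mono) auto
      moreover have "\<bar>?g (?a t) (?b t)\<bar> \<le> C * (1 + (?b t)\<^sup>2) \<and> \<bar>?d (?a t) (?b t)\<bar> \<le> C * (1 + (?b t)\<^sup>2)"
        using that ab by (intro C[rule_format]) auto
      ultimately show ?thesis by linarith
    qed
    have "(\<integral>t. ?g (?a t) (?b t) + ?d (?a t) (?b t) / lam \<partial>density lborel (exponential_density lam))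
      = ?g (?a 0) (?b 0)"
    \<comment> \<open>Exceptional times: a server empties, or \<open>a - t / 2\<close> passes a kink
      of \<open>p\<close>. From \<open>T\<close> on both servers are empty.\<close>
    proof (rule exponential_service_identity[OF lam, where F = "{2 * a, 2 * b} \<union> (\<lambda>f. 2 * (a - f)) ` F"
          and C = "\<bar>C\<bar> * (1 + b\<^sup>2)" and T = "max (2 * a) (2 * b)"])
      show "continuous_on {0..} (\<lambda>t. ?g (?a t) (?b t))"
        by (intro continuous_intros continuous_on_compose2[OF cont]) auto
      show "finite ({2 * a, 2 * b} \<union> (\<lambda>f. 2 * (a - f)) ` F)" using F by simp
      show "(\<lambda>t. ?g (?a t) (?b t)) \<in> borel_measurable borel"
        "(\<lambda>t. ?d (?a t) (?b t)) \<in> borel_measurable borel" by measurable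
      show "0 \<le> max (2 * a) (2 * b)" using ab by auto
      fix t :: real
      { assume "0 \<le> t"
        then show "\<bar>?g (?a t) (?b t)\<bar> \<le> \<bar>C\<bar> * (1 + b\<^sup>2)" "\<bar>?d (?a t) (?b t)\<bar> \<le> \<bar>C\<bar> * (1 + b\<^sup>2)"
          using bnd[of t] by auto }
      { assume "max (2 * a) (2 * b) \<le> t"
        then have "?a t = 0" "?b t = 0" "?a (max (2 * a) (2 * b)) = 0" "?b (max (2 * a) (2 * b)) = 0"
          by auto
        then show "?g (?a t) (?b t) = ?g (?a (max (2 * a) (2 * b))) (?b (max (2 * a) (2 * b)))"
          "?d (?a t) (?b t) = 0" by simp_all }
      assume t: "0 < t" "t \<notin> {2 * a, 2 * b} \<union> (\<lambda>f. 2 * (a - f)) ` F"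
      have "((\<lambda>t. p (?a t)) has_real_derivative - (of_bool (0 < ?a t) * p' (?a t) / 2)) (at t)"
        by (rule served_deriv[OF deriv]) (use t in \<open>auto simp: image_iff field_simps\<close>)
      moreover have "((\<lambda>t. (?b t) ^ j) has_real_derivative
          - (of_bool (0 < ?b t) * (real j * ?b t ^ (j - 1)) / 2)) (at t)"
        by (rule served_deriv[where F = "{}" and p = "\<lambda>b. b ^ j"])
          (use t in \<open>auto intro!: derivative_eq_intros\<close>)
      ultimately have "((\<lambda>t. ?g (?a t) (?b t)) has_real_derivative
         - (of_bool (0 < ?a t) * p' (?a t) / 2) * (?b t) ^ j
         + - (of_bool (0 < ?b t) * (real j * ?b t ^ (j - 1)) / 2) * p (?a t)) (at t)"
        by (rule DERIV_mult)
      then show "((\<lambda>t. ?g (?a t) (?b t)) has_real_derivative - ?d (?a t) (?b t)) (at t)"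
        by (rule DERIV_cong) (simp add: field_simps)
    qed
    then show "(\<integral>t. ?g (?a t) (?b t) + ?d (?a t) (?b t) / lam \<partial>density lborel (exponential_density lam))
      = ?g a b" using ab by simp
  qed
qed

section \<open>Drift bounds\<close>

locale card_drift = prob_space D for D :: "real measure" +
  fixes lam m_minus m_plus c \<alpha> \<beta> \<epsilon> :: real
  assumes sets_D [measurable_cong]: "sets D = sets borel"
    and size_pos: "AE x in D. 0 < x"
    and size_sq: "integrable D (\<lambda>x. x ^ 2)"
    and lam_pos: "0 < lam"
    and thresholds: "0 \<le> m_minus" "m_minus \<le> m_plus" "m_plus \<le> c"
    and load_minus: "lam * (\<integral>x. x * indicator {..<m_minus} x \<partial>D) = 1/2 - \<alpha>"
    and load_plus: "lam * (\<integral>x. x * indicator {..<m_plus} x \<partial>D) = 1/2 + \<beta>"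
    and load_total: "lam * (\<integral>x. x \<partial>D) = 1 - \<epsilon>"
    and alpha_pos: "0 < \<alpha>" and alpha_le: "\<alpha> \<le> 1/2"
    and beta_pos: "0 < \<beta>" and beta_le: "\<beta> \<le> 1/2"
    and eps_pos: "0 < \<epsilon>" and m_plus_pos: "0 < m_plus"
begin

text \<open>Because \<open>m_minus \<le> m_plus\<close>, CARD's three size classes amount to one
  threshold that depends on the short work.\<close>

definition cutoff :: "real \<Rightarrow> real" where
  "cutoff a = (if a \<le> c then m_plus else m_minus)"

lemma cutoff_iff: "card_to_short m_minus m_plus c a s \<longleftrightarrow> s < cutoff a"
  using thresholds by (auto simp: card_to_short_def cutoff_def)

definition post :: "(real \<Rightarrow> real \<Rightarrow> real) \<Rightarrow> real \<Rightarrow> real \<Rightarrow> real \<Rightarrow> real" where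
  "post g a b s = (if s < cutoff a then g (a + s) b else g a (b + s))"

text \<open>The generator of the continuous-time workload process applied to \<open>g\<close>:
  Poisson jumps at rate \<open>lam\<close>, and service contributing \<open>- dg\<close>.\<close>

definition drift :: "(real \<Rightarrow> real \<Rightarrow> real) \<Rightarrow> (real \<Rightarrow> real \<Rightarrow> real) \<Rightarrow> real \<Rightarrow> real \<Rightarrow> real" where
  "drift g dg a b = lam * ((\<integral>s. post g a b s \<partial>D) - g a b) - dg a b"

lemma size_integrable: "integrable D (\<lambda>s. s)"
  using size_sq by (rule square_integrable_imp_integrable[rotated]) simp

lemma integrable_short: "integrable D (\<lambda>s. s * indicator {..<t} s)"
  using size_integrable by (rule Bochner_Integration.integrable_bound) (auto simp: indicator_def)

lemma load_cutoff: "lam * (\<integral>s. s * indicator {..<cutoff a} s \<partial>D) = 1/2 + \<beta> - (\<alpha> + \<beta>) * of_bool (c < a)"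
  using load_minus load_plus by (simp add: cutoff_def)

lemma cutoff_le: "cutoff a \<le> m_plus"
  using thresholds by (simp add: cutoff_def)

lemma post_measurable [measurable]:
  assumes "service_pair lam g dg"
  shows "(\<lambda>(w, s). post g (fst w) (snd w) s) \<in> borel_measurable ((borel \<Otimes>\<^sub>M borel) \<Otimes>\<^sub>M borel)"
proof -
  note m[measurable] = measurable_compose[OF _ service_pair_measurable(1)[OF assms]]
  have 1: "(\<lambda>x. g (fst (fst x) + snd x) (snd (fst x))) \<in> borel_measurable ((borel \<Otimes>\<^sub>M borel) \<Otimes>\<^sub>M borel)"
    using measurable_compose[OF _ service_pair_measurable(1)[OF assms],
        of "\<lambda>x. (fst (fst x) + snd x, snd (fst x))"] by simp
  have 2: "(\<lambda>x. g (fst (fst x)) (snd (fst x) + snd x)) \<in> borel_measurable ((borel \<Otimes>\<^sub>M borel) \<Otimes>\<^sub>M borel)"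
    using measurable_compose[OF _ service_pair_measurable(1)[OF assms],
        of "\<lambda>x. (fst (fst x), snd (fst x) + snd x)"] by simp
  show ?thesis
    unfolding post_def cutoff_def split_beta' using 1 2 by measurable
qed

lemma post_integrable:
  assumes sp: "service_pair lam g dg" and ab: "0 \<le> a" "0 \<le> b"
  shows "integrable D (post g a b)"
proof -
  obtain C where C: "0 \<le> C" "\<And>a' b. 0 \<le> a' \<Longrightarrow> a' \<le> a + m_plus \<Longrightarrow> 0 \<le> b \<Longrightarrow>
      \<bar>g a' b\<bar> \<le> C * (1 + b\<^sup>2) \<and> \<bar>dg a' b\<bar> \<le> C * (1 + b\<^sup>2)"
    using service_pair_bound[OF sp, of "a + m_plus"] by blast
  have "(\<lambda>s. ((a, b), s)) \<in> borel \<rightarrow>\<^sub>M (borel \<Otimes>\<^sub>M borel) \<Otimes>\<^sub>M borel" by simp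
  from measurable_compose[OF this post_measurable[OF sp]]
  have m: "post g a b \<in> borel_measurable D"
    unfolding split_beta' by (simp cong: measurable_cong_sets[OF sets_D refl])
  have "integrable D (\<lambda>s. C * (1 + 2 * b\<^sup>2 + 2 * s\<^sup>2))"
    using size_sq by simp
  then show ?thesis
  proof (rule Bochner_Integration.integrable_bound[OF _ m])
    show "AE s in D. norm (post g a b s) \<le> norm (C * (1 + 2 * b\<^sup>2 + 2 * s\<^sup>2))"
      using size_pos
    proof eventually_elim
      case (elim s)
      have sq: "(b + s)\<^sup>2 \<le> 2 * b\<^sup>2 + 2 * s\<^sup>2"
        using sum_squares_bound[of b s] by (simp add: power2_sum)
      have "\<bar>post g a b s\<bar> \<le> C * (1 + (b + s)\<^sup>2)"
      proof (cases "s < cutoff a")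
        case True
        then have "\<bar>post g a b s\<bar> \<le> C * (1 + b\<^sup>2)"
          using C(2)[of "a + s" b] cutoff_le[of a] elim ab by (simp add: post_def)
        also have "\<dots> \<le> C * (1 + (b + s)\<^sup>2)"
          using C(1) elim ab by (intro mult_left_mono add_left_mono power_mono) auto
        finally show ?thesis .
      next
        case False
        then show ?thesis
          using C(2)[of a "b + s"] m_plus_pos elim ab by (simp add: post_def)
      qed
      also have "\<dots> \<le> C * (1 + 2 * b\<^sup>2 + 2 * s\<^sup>2)"
        using C(1) sq by (intro mult_left_mono) auto
      also have "\<dots> \<le> \<bar>C * (1 + 2 * b\<^sup>2 + 2 * s\<^sup>2)\<bar>" by simp
      finally show ?case by simp
    qed
  qed
qed

lemma drift_lincomb:
  assumes "service_pair lam g1 d1" "service_pair lam g2 d2" "0 \<le> a" "0 \<le> b"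
  shows "drift (\<lambda>a b. x * g1 a b + y * g2 a b) (\<lambda>a b. x * d1 a b + y * d2 a b) a b
     = x * drift g1 d1 a b + y * drift g2 d2 a b"
proof -
  have "post (\<lambda>a b. x * g1 a b + y * g2 a b) a b s = x * post g1 a b s + y * post g2 a b s" for s
    by (simp add: post_def)
  then show ?thesis
    using post_integrable[OF assms(1,3,4)] post_integrable[OF assms(2-4)]
    by (simp add: drift_def algebra_simps)
qed

text \<open>Reduces each drift bound to a pointwise inequality in the job size. The three functions
  of \<open>s\<close> on the right are those whose \<open>lam\<close>-weighted means are known:
  short load, total load and second moment.\<close>

lemma drift_le:
  assumes sp: "service_pair lam g dg" and ab: "0 \<le> a" "0 \<le> b"
    and le: "\<And>s. 0 < s \<Longrightarrow> post g a b s - g a b \<le> k1 * (s * indicator {..<cutoff a} s) + k2 * s + k3 * s\<^sup>2"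
  shows "drift g dg a b \<le> k1 * (1/2 + \<beta> - (\<alpha> + \<beta>) * of_bool (c < a)) + k2 * (1 - \<epsilon>)
           + k3 * (lam * (\<integral>s. s\<^sup>2 \<partial>D)) - dg a b"
proof -
  have "(\<integral>s. post g a b s - g a b \<partial>D)
      \<le> (\<integral>s. k1 * (s * indicator {..<cutoff a} s) + k2 * s + k3 * s\<^sup>2 \<partial>D)"
    by (rule integral_mono_AE)
      (use post_integrable[OF sp ab] size_sq size_integrable integrable_short size_pos
        in \<open>auto intro!: le elim: eventually_mono\<close>)
  also have "\<dots> = k1 * (\<integral>s. s * indicator {..<cutoff a} s \<partial>D) + k2 * (\<integral>s. s \<partial>D) + k3 * (\<integral>s. s\<^sup>2 \<partial>D)"
    using size_sq size_integrable integrable_short by simp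
  finally have "lam * (\<integral>s. post g a b s - g a b \<partial>D)
      \<le> lam * (k1 * (\<integral>s. s * indicator {..<cutoff a} s \<partial>D) + k2 * (\<integral>s. s \<partial>D) + k3 * (\<integral>s. s\<^sup>2 \<partial>D))"
    using lam_pos by (intro mult_left_mono) auto
  also have "\<dots> = k1 * (lam * (\<integral>s. s * indicator {..<cutoff a} s \<partial>D)) + k2 * (lam * (\<integral>s. s \<partial>D))
      + k3 * (lam * (\<integral>s. s\<^sup>2 \<partial>D))" by (simp add: algebra_simps)
  finally show ?thesis
    using post_integrable[OF sp ab] by (simp add: drift_def load_cutoff load_total prob_space)
qed

section \<open>The eight components of the Lyapunov function\<close>

text \<open>Below \<open>c\<close> the short work has upward drift \<open>\<beta>\<close> and jumps
  at most \<open>m_plus\<close>; at this exponent \<open>exp (- \<theta> * a)\<close> has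
  nonpositive drift there.\<close>

definition "\<theta> = \<beta> / m_plus"

abbreviation "excess a \<equiv> max 0 (a - c)"

lemma service_pair_cong:
  assumes "service_pair lam g dg" "\<And>a b. g' a b = g a b" "\<And>a b. dg' a b = dg a b"
  shows "service_pair lam g' dg'"
proof -
  have "g' = g" "dg' = dg" using assms by (auto intro!: ext)
  then show ?thesis using assms(1) by simp
qed

lemma service_pair_monomial:
  assumes "j \<le> 2"
  shows "service_pair lam (\<lambda>a b. a ^ i * b ^ j)
    (\<lambda>a b. (of_bool (0 < a) * (real i * a ^ (i - 1)) * b ^ j + of_bool (0 < b) * a ^ i * (real j * b ^ (j - 1))) / 2)"
proof (rule service_pair_power[OF lam_pos, where F = "{}"])
  fix A :: real
  have "compact ((\<lambda>t. real i * t ^ (i - 1)) ` {0..A})"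
    by (intro compact_continuous_image continuous_intros) auto
  from compact_imp_bounded[OF this]
  obtain C where "\<forall>x \<in> (\<lambda>t. real i * t ^ (i - 1)) ` {0..A}. norm x \<le> C"
    unfolding bounded_iff ..
  then show "\<exists>C. \<forall>t. 0 \<le> t \<longrightarrow> t \<le> A \<longrightarrow> \<bar>real i * t ^ (i - 1)\<bar> \<le> C"
    by (intro exI[of _ C]) simp
next
  fix t :: real
  show "((\<lambda>a. a ^ i) has_real_derivative real i * t ^ (i - 1)) (at t)"
    using DERIV_pow[of i t] by simp
next
  show "continuous_on {0..} (\<lambda>a :: real. a ^ i)" by (intro continuous_intros)
qed (use assms in simp_all)

definition "lyap_short a b = (a :: real)" for b :: real
definition "rate_short a b = of_bool (0 < a) / (2 :: real)" for a b :: real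

lemma service_pair_short: "service_pair lam lyap_short rate_short"
  by (rule service_pair_cong[OF service_pair_monomial[of 0 1]]) (auto simp: lyap_short_def rate_short_def)

text \<open>A short job arriving at \<open>a \<le> c\<close> leaves an excess \<open>u\<close> below
  \<open>m_plus\<close>, so \<open>u^2 - m_plus * u \<le> 0\<close>: crossing \<open>c\<close> costs
  nothing. Above \<open>c\<close> the same correction cancels the \<open>s^2\<close> of the jump.
  Its price is \<open>m_plus / 2\<close> from serving the linear term while
  \<open>c < a\<close>.\<close>

definition "lyap_excess_sq a b = (excess a)\<^sup>2 - m_plus * excess a" for b :: real
definition "rate_excess_sq a b = of_bool (c < a) * (2 * excess a - m_plus) / 2" for b :: real

lemma c_nonneg: "0 \<le> c" using thresholds m_plus_pos by linarith

lemma service_pair_excess_sq: "service_pair lam lyap_excess_sq rate_excess_sq"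
proof (rule service_pair_cong[OF service_pair_power[OF lam_pos, where F = "{c}" and j = 0
     and p = "\<lambda>a. (excess a)\<^sup>2 - m_plus * excess a" and p' = "\<lambda>a. of_bool (c < a) * (2 * excess a - m_plus)"]])
  fix t :: real assume t: "t \<notin> {c}"
  show "((\<lambda>a. (excess a)\<^sup>2 - m_plus * excess a) has_real_derivative
      of_bool (c < t) * (2 * excess t - m_plus)) (at t)"
  proof (cases "c < t")
    case True
    have "((\<lambda>a. (a - c)\<^sup>2 - m_plus * (a - c)) has_real_derivative 2 * (t - c) - m_plus) (at t)"
      by (auto intro!: derivative_eq_intros)
    then have "((\<lambda>a. (excess a)\<^sup>2 - m_plus * excess a) has_real_derivative 2 * (t - c) - m_plus) (at t)"
      by (rule has_field_derivative_transform_within_open[where S = "{c<..}"]) (use True in auto)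
    then show ?thesis using True by simp
  next
    case False
    have "((\<lambda>a. 0) has_real_derivative 0) (at t)" by simp
    then have "((\<lambda>a. (excess a)\<^sup>2 - m_plus * excess a) has_real_derivative 0) (at t)"
      by (rule has_field_derivative_transform_within_open[where S = "{..<c}"]) (use False t in auto)
    then show ?thesis using False by simp
  qed
next
  fix A :: real
  show "\<exists>C. \<forall>t. 0 \<le> t \<longrightarrow> t \<le> A \<longrightarrow> \<bar>of_bool (c < t) * (2 * excess t - m_plus)\<bar> \<le> C"
    by (rule exI[of _ "2 * A + m_plus"]) (use c_nonneg m_plus_pos in \<open>auto simp: abs_le_iff\<close>)
next
  show "continuous_on {0..} (\<lambda>a. (excess a)\<^sup>2 - m_plus * excess a)" by (intro continuous_intros)
qed (use c_nonneg in \<open>simp_all add: lyap_excess_sq_def rate_excess_sq_def\<close>)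

text \<open>The same device one degree higher, from \<open>u^3 \<le> m_plus^2 * u\<close>. Its drift
  supplies the negative \<open>u^2\<close> that pays for Young's inequality;
  \<open>lyap_excess_sq\<close> cancels the remainder linear in \<open>u\<close>.\<close>

definition "lyap_excess_cube a b = (excess a) ^ 3 - m_plus\<^sup>2 * excess a" for b :: real
definition "rate_excess_cube a b = of_bool (c < a) * (3 * (excess a)\<^sup>2 - m_plus\<^sup>2) / 2" for b :: real

lemma service_pair_excess_cube: "service_pair lam lyap_excess_cube rate_excess_cube"
proof (rule service_pair_cong[OF service_pair_power[OF lam_pos, where F = "{c}" and j = 0
     and p = "\<lambda>a. (excess a) ^ 3 - m_plus\<^sup>2 * excess a" and p' = "\<lambda>a. of_bool (c < a) * (3 * (excess a)\<^sup>2 - m_plus\<^sup>2)"]])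
  fix t :: real assume t: "t \<notin> {c}"
  show "((\<lambda>a. (excess a) ^ 3 - m_plus\<^sup>2 * excess a) has_real_derivative
      of_bool (c < t) * (3 * (excess t)\<^sup>2 - m_plus\<^sup>2)) (at t)"
  proof (cases "c < t")
    case True
    have "((\<lambda>a. (a - c) ^ 3 - m_plus\<^sup>2 * (a - c)) has_real_derivative 3 * (t - c)\<^sup>2 - m_plus\<^sup>2) (at t)"
      by (auto intro!: derivative_eq_intros)
    then have "((\<lambda>a. (excess a) ^ 3 - m_plus\<^sup>2 * excess a) has_real_derivative 3 * (t - c)\<^sup>2 - m_plus\<^sup>2) (at t)"
      by (rule has_field_derivative_transform_within_open[where S = "{c<..}"]) (use True in auto)
    then show ?thesis using True by simp
  next
    case False
    have "((\<lambda>a. 0) has_real_derivative 0) (at t)" by simp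
    then have "((\<lambda>a. (excess a) ^ 3 - m_plus\<^sup>2 * excess a) has_real_derivative 0) (at t)"
      by (rule has_field_derivative_transform_within_open[where S = "{..<c}"]) (use False t in auto)
    then show ?thesis using False by simp
  qed
next
  fix A :: real
  have "\<bar>of_bool (c < t) * (3 * (excess t)\<^sup>2 - m_plus\<^sup>2)\<bar> \<le> 3 * A\<^sup>2 + m_plus\<^sup>2" if "0 \<le> t" "t \<le> A" for t
  proof -
    have "(excess t)\<^sup>2 \<le> A\<^sup>2" using that c_nonneg by (intro power_mono) auto
    moreover have "0 \<le> (excess t)\<^sup>2" "0 \<le> m_plus\<^sup>2" "0 \<le> A\<^sup>2" by auto
    ultimately have "\<bar>3 * (excess t)\<^sup>2 - m_plus\<^sup>2\<bar> \<le> 3 * A\<^sup>2 + m_plus\<^sup>2" by linarith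
    then show ?thesis by (cases "c < t") auto
  qed
  then show "\<exists>C. \<forall>t. 0 \<le> t \<longrightarrow> t \<le> A \<longrightarrow> \<bar>of_bool (c < t) * (3 * (excess t)\<^sup>2 - m_plus\<^sup>2)\<bar> \<le> C"
    by blast
next
  show "continuous_on {0..} (\<lambda>a. (excess a) ^ 3 - m_plus\<^sup>2 * excess a)" by (intro continuous_intros)
qed (use c_nonneg in \<open>simp_all add: lyap_excess_cube_def rate_excess_cube_def\<close>)

text \<open>Its negative drift at \<open>a = 0\<close> cancels the idle term that
  \<open>lyap_short\<close> produces when the short server has nothing to serve.\<close>

definition "lyap_exp a b = exp (- \<theta> * a)" for b :: real
definition "rate_exp a b = - of_bool (0 < a) * \<theta> * exp (- \<theta> * a) / 2" for b :: real
definition "lyap_exp_long a b = exp (- \<theta> * a) * b"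
definition "rate_exp_long a b = (- of_bool (0 < a) * \<theta> * exp (- \<theta> * a) * b + of_bool (0 < b) * exp (- \<theta> * a)) / 2" for b :: real

lemma theta_pos: "0 < \<theta>"
  using beta_pos m_plus_pos by (simp add: \<theta>_def)

lemma service_pair_exp_power:
  assumes "j \<le> 2"
  shows "service_pair lam (\<lambda>a b. exp (- \<theta> * a) * b ^ j)
    (\<lambda>a b. (of_bool (0 < a) * (- \<theta> * exp (- \<theta> * a)) * b ^ j + of_bool (0 < b) * exp (- \<theta> * a) * (real j * b ^ (j - 1))) / 2)"
proof (rule service_pair_power[OF lam_pos, where F = "{}"])
  fix A :: real
  show "\<exists>C. \<forall>t. 0 \<le> t \<longrightarrow> t \<le> A \<longrightarrow> \<bar>- \<theta> * exp (- \<theta> * t)\<bar> \<le> C"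
    by (rule exI[of _ \<theta>]) (use theta_pos in \<open>auto simp: abs_mult\<close>)
next
  fix t :: real
  show "((\<lambda>a. exp (- \<theta> * a)) has_real_derivative - \<theta> * exp (- \<theta> * t)) (at t)"
    by (auto intro!: derivative_eq_intros)
next
  show "continuous_on {0..} (\<lambda>a :: real. exp (- \<theta> * a))" by (intro continuous_intros)
qed (use assms in simp_all)

lemma service_pair_exp: "service_pair lam lyap_exp rate_exp"
  by (rule service_pair_cong[OF service_pair_exp_power[of 0]]) (auto simp: lyap_exp_def rate_exp_def)

lemma service_pair_exp_long: "service_pair lam lyap_exp_long rate_exp_long"
  by (rule service_pair_cong[OF service_pair_exp_power[of 1]]) (auto simp: lyap_exp_long_def rate_exp_long_def)

definition "lyap_short_total a b = a * (a + b)" for a b :: real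
definition "rate_short_total a b = (of_bool (0 < a) * (2 * a + b) + of_bool (0 < b) * a) / 2" for a b :: real

lemma service_pair_short_total: "service_pair lam lyap_short_total rate_short_total"
  by (rule service_pair_cong[OF service_pair_lincomb[OF service_pair_monomial[of 0 2] service_pair_monomial[of 1 1] lam_pos, of 1 1]])
    (auto simp: lyap_short_total_def rate_short_total_def power2_eq_square algebra_simps)

definition "lyap_total_sq a b = (a + b)\<^sup>2" for a b :: real
definition "rate_total_sq a b = (of_bool (0 < a) + of_bool (0 < b)) * (a + b)" for a b :: real

lemma service_pair_total_sq: "service_pair lam lyap_total_sq rate_total_sq"
  by (rule service_pair_cong[OF service_pair_lincomb[OF service_pair_monomial[of 0 2]
        service_pair_lincomb[OF service_pair_monomial[of 1 1] service_pair_monomial[of 2 0] lam_pos, of 2 1] lam_pos, of 1 1]])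
    (auto simp: lyap_total_sq_def rate_total_sq_def power2_eq_square algebra_simps)

definition "lyap_neg_total a b = - (a + b)" for a b :: real
definition "rate_neg_total a b = - (of_bool (0 < a) + of_bool (0 < b)) / 2" for a b :: real

lemma service_pair_neg_total: "service_pair lam lyap_neg_total rate_neg_total"
  by (rule service_pair_cong[OF service_pair_lincomb[OF service_pair_monomial[of 0 1] service_pair_monomial[of 1 0] lam_pos, of "-1" "-1"]])
    (auto simp: lyap_neg_total_def rate_neg_total_def field_simps)

section \<open>Drift of each component\<close>

lemma drift_short_le:
  assumes "0 \<le> a" "0 \<le> b"
  shows "drift lyap_short rate_short a b \<le> \<beta> - (\<alpha> + \<beta>) * of_bool (c < a) + of_bool (a = 0) / 2"
proof -
  have "drift lyap_short rate_short a b \<le> 1 * (1/2 + \<beta> - (\<alpha> + \<beta>) * of_bool (c < a)) + 0 * (1 - \<epsilon>)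
           + 0 * (lam * (\<integral>s. s\<^sup>2 \<partial>D)) - rate_short a b"
    by (rule drift_le[OF service_pair_short assms]) (auto simp: post_def lyap_short_def)
  then show ?thesis using assms by (auto simp: rate_short_def)
qed

lemma drift_excess_sq_le:
  assumes "0 \<le> a" "0 \<le> b"
  shows "drift lyap_excess_sq rate_excess_sq a b \<le> of_bool (c < a) * (- 2 * \<alpha> * excess a + m_plus / 2)"
proof (cases "c < a")
  case True
  have "drift lyap_excess_sq rate_excess_sq a b \<le> (2 * excess a) * (1/2 + \<beta> - (\<alpha> + \<beta>) * of_bool (c < a)) + 0 * (1 - \<epsilon>)
           + 0 * (lam * (\<integral>s. s\<^sup>2 \<partial>D)) - rate_excess_sq a b"
  proof (rule drift_le[OF service_pair_excess_sq assms])
    fix s :: real assume s: "0 < s"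
    have "s * s \<le> m_plus * s" if "s < cutoff a" using cutoff_le[of a] s that by (intro mult_right_mono) auto
    then show "post lyap_excess_sq a b s - lyap_excess_sq a b \<le> 2 * excess a * (s * indicator {..<cutoff a} s) + 0 * s + 0 * s\<^sup>2"
      using True s by (auto simp: post_def lyap_excess_sq_def power2_eq_square algebra_simps)
  qed
  then show ?thesis
    using True by (simp add: rate_excess_sq_def algebra_simps add_divide_distrib diff_divide_distrib)
next
  case False
  have "drift lyap_excess_sq rate_excess_sq a b \<le> 0 * (1/2 + \<beta> - (\<alpha> + \<beta>) * of_bool (c < a)) + 0 * (1 - \<epsilon>)
           + 0 * (lam * (\<integral>s. s\<^sup>2 \<partial>D)) - rate_excess_sq a b"
  proof (rule drift_le[OF service_pair_excess_sq assms])
    fix s :: real assume s: "0 < s"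
    have "excess (a + s) * excess (a + s) \<le> m_plus * excess (a + s)" if "s < cutoff a"
      using cutoff_le[of a] s that False by (intro mult_right_mono) auto
    then show "post lyap_excess_sq a b s - lyap_excess_sq a b \<le> 0 * (s * indicator {..<cutoff a} s) + 0 * s + 0 * s\<^sup>2"
      using False s by (auto simp: post_def lyap_excess_sq_def power2_eq_square)
  qed
  then show ?thesis using False by (simp add: rate_excess_sq_def)
qed

lemma drift_excess_cube_le:
  assumes "0 \<le> a" "0 \<le> b"
  shows "drift lyap_excess_cube rate_excess_cube a b \<le> of_bool (c < a) * (- 3 * \<alpha> * (excess a)\<^sup>2 + 3/2 * m_plus * excess a + m_plus\<^sup>2 / 2)"
proof (cases "c < a")
  case True
  let ?u = "excess a"
  have "drift lyap_excess_cube rate_excess_cube a b \<le> (3 * ?u\<^sup>2 + 3 * ?u * m_plus) * (1/2 + \<beta> - (\<alpha> + \<beta>) * of_bool (c < a)) + 0 * (1 - \<epsilon>)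
           + 0 * (lam * (\<integral>s. s\<^sup>2 \<partial>D)) - rate_excess_cube a b"
  proof (rule drift_le[OF service_pair_excess_cube assms])
    fix s :: real assume s: "0 < s"
    show "post lyap_excess_cube a b s - lyap_excess_cube a b \<le> (3 * ?u\<^sup>2 + 3 * ?u * m_plus) * (s * indicator {..<cutoff a} s) + 0 * s + 0 * s\<^sup>2"
    proof (cases "s < cutoff a")
      case sh: True
      then have sm: "s \<le> m_plus" using cutoff_le[of a] by linarith
      have u: "0 \<le> ?u" by simp
      have 1: "s * s \<le> m_plus * s" using sm s by (intro mult_right_mono) auto
      have "3 * ?u * (s * s) \<le> 3 * ?u * (m_plus * s)" by (intro mult_left_mono 1) auto
      \<comment> \<open>The correction \<open>- m_plus^2 * u\<close> changes by
        \<open>- m_plus^2 * s\<close>, which absorbs this cubic term of the expansion.\<close>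
      moreover have "s * s * s \<le> m_plus * m_plus * s" using sm s by (intro mult_right_mono mult_mono) auto
      ultimately have "(?u + s) ^ 3 - m_plus\<^sup>2 * (?u + s) - (?u ^ 3 - m_plus\<^sup>2 * ?u)
          \<le> (3 * ?u\<^sup>2 + 3 * ?u * m_plus) * s"
        by (simp add: power2_eq_square power3_eq_cube algebra_simps)
      moreover have "excess (a + s) = ?u + s" using True s by simp
      ultimately show ?thesis using sh by (simp add: post_def lyap_excess_cube_def)
    qed (simp add: post_def lyap_excess_cube_def)
  qed
  moreover define u where "u = ?u"
  ultimately have "drift lyap_excess_cube rate_excess_cube a b \<le> (3 * u\<^sup>2 + 3 * u * m_plus) * (1/2 - \<alpha>) - (3 * u\<^sup>2 - m_plus\<^sup>2) / 2"
    using True unfolding rate_excess_cube_def u_def[symmetric] by simp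
  also have "\<dots> = - 3 * \<alpha> * u\<^sup>2 + 3/2 * m_plus * u + m_plus\<^sup>2 / 2 - 3 * (u * m_plus * \<alpha>)"
    by (simp add: field_simps)
  also have "\<dots> \<le> - 3 * \<alpha> * u\<^sup>2 + 3/2 * m_plus * u + m_plus\<^sup>2 / 2"
    using alpha_pos m_plus_pos by (simp add: u_def)
  finally show ?thesis using True unfolding u_def[symmetric] by simp
next
  case False
  have "drift lyap_excess_cube rate_excess_cube a b \<le> 0 * (1/2 + \<beta> - (\<alpha> + \<beta>) * of_bool (c < a)) + 0 * (1 - \<epsilon>)
           + 0 * (lam * (\<integral>s. s\<^sup>2 \<partial>D)) - rate_excess_cube a b"
  proof (rule drift_le[OF service_pair_excess_cube assms])
    fix s :: real assume s: "0 < s"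
    have "excess (a + s) * excess (a + s) * excess (a + s) \<le> m_plus * m_plus * excess (a + s)" if "s < cutoff a"
      using cutoff_le[of a] s that False by (intro mult_right_mono mult_mono) auto
    then show "post lyap_excess_cube a b s - lyap_excess_cube a b \<le> 0 * (s * indicator {..<cutoff a} s) + 0 * s + 0 * s\<^sup>2"
      using False s by (auto simp: post_def lyap_excess_cube_def power2_eq_square power3_eq_cube)
  qed
  then show ?thesis using False by (simp add: rate_excess_cube_def)
qed

text \<open>Since \<open>\<theta> * s \<le> \<beta>\<close>, the second-order term is at most a
  fraction \<open>\<beta> / 2\<close> of the first. A bound linear in \<open>s\<close> is needed
  because only the short load, not a higher moment, is prescribed.\<close>

lemma exp_diff_le:
  assumes "0 < s" "s \<le> m_plus"
  shows "exp (- \<theta> * (a + s)) - exp (- \<theta> * a) \<le> exp (- \<theta> * a) * (- \<theta> * (1 - \<beta> / 2)) * s"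
proof -
  let ?y = "\<theta> * s"
  have y0: "0 \<le> ?y" using theta_pos assms by simp
  have "exp (- ?y) \<le> 1 - ?y + ?y\<^sup>2 / 2"
  proof -
    have sq: "0 \<le> 1 - ?y + ?y\<^sup>2 / 2"
      using zero_le_power2[of "?y - 1"] by (simp add: power2_diff)
    \<comment> \<open>The upper bound on \<open>exp (- y)\<close> comes from the lower Taylor bound
      on \<open>exp y\<close>: the product of the two quadratics is
      \<open>1 + y^4 / 4 \<ge> 1\<close>.\<close>
    have "1 \<le> 1 + (?y\<^sup>2)\<^sup>2 / 4" by simp
    also have "\<dots> = (1 + ?y + ?y\<^sup>2 / 2) * (1 - ?y + ?y\<^sup>2 / 2)"
      by (simp add: power2_eq_square field_simps)
    also have "\<dots> \<le> exp ?y * (1 - ?y + ?y\<^sup>2 / 2)"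
      using exp_lower_Taylor_quadratic[OF y0] sq by (intro mult_right_mono) auto
    finally have "exp (- ?y) * 1 \<le> exp (- ?y) * (exp ?y * (1 - ?y + ?y\<^sup>2 / 2))"
      by (intro mult_left_mono) auto
    then show ?thesis by (simp add: mult.assoc[symmetric] exp_add[symmetric])
  qed
  also have "\<dots> \<le> 1 - ?y + ?y * \<beta> / 2"
  proof -
    have "?y \<le> \<beta>" using assms m_plus_pos beta_pos by (simp add: \<theta>_def field_simps)
    then show ?thesis using y0 by (simp add: power2_eq_square mult_left_mono)
  qed
  finally have "exp (- \<theta> * a) * exp (- ?y) \<le> exp (- \<theta> * a) * (1 - ?y + ?y * \<beta> / 2)" by simp
  moreover have "exp (- \<theta> * (a + s)) = exp (- \<theta> * a) * exp (- ?y)"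
    by (simp add: exp_add[symmetric] algebra_simps)
  ultimately show ?thesis by (simp add: algebra_simps)
qed

text \<open>Below \<open>c\<close> the loss from linearising is affordable:
  \<open>(1 - \<beta> / 2) * (1/2 + \<beta>) \<ge> 1/2\<close> because
  \<open>\<beta> \<le> 1/2\<close>, so arrivals outweigh service, and at \<open>a = 0\<close>, where
  service is absent, a negative amount is left. Above \<open>c\<close> the drift may be positive,
  but there the exponential is at most \<open>exp (- \<theta> * c)\<close>.\<close>

lemma exp_rate_le:
  assumes "0 \<le> a"
  shows "exp (- \<theta> * a) * (- \<theta> * (1 - \<beta> / 2)) * (1/2 + \<beta> - (\<alpha> + \<beta>) * of_bool (c < a))
       + of_bool (0 < a) * \<theta> * exp (- \<theta> * a) / 2
     \<le> \<theta> * (- of_bool (a = 0) / 2 + (\<alpha> + \<beta>) * exp (- \<theta> * c) * of_bool (c < a))"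
proof (cases "c < a")
  case True
  have "exp (- \<theta> * a) \<le> exp (- \<theta> * c)" using True theta_pos by simp
  moreover have "1/2 - (1 - \<beta> / 2) * (1/2 - \<alpha>) = \<alpha> + \<beta> / 4 - \<beta> * \<alpha> / 2"
    by (simp add: field_simps)
  moreover have "\<beta> * \<alpha> \<le> \<beta> * (1/2)" using alpha_le beta_pos by (intro mult_left_mono) auto
  moreover have "0 \<le> \<beta> * \<alpha>" using alpha_pos beta_pos by simp
  ultimately have "exp (- \<theta> * a) * (1/2 - (1 - \<beta> / 2) * (1/2 - \<alpha>)) \<le> exp (- \<theta> * c) * (\<alpha> + \<beta>)"
    using alpha_pos beta_pos by (intro mult_mono; use exp_ge_zero[of "- \<theta> * c"] in linarith)
  then have "\<theta> * (exp (- \<theta> * a) * (1/2 - (1 - \<beta> / 2) * (1/2 - \<alpha>))) \<le> \<theta> * (exp (- \<theta> * c) * (\<alpha> + \<beta>))"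
    using theta_pos by (intro mult_left_mono) auto
  then show ?thesis
    using True c_nonneg by (simp add: algebra_simps add_divide_distrib diff_divide_distrib)
next
  case False
  have "\<beta> * \<beta> \<le> \<beta> / 2" using beta_le beta_pos mult_left_mono[of \<beta> "1/2" \<beta>] by auto
  then have "1/2 \<le> (1 - \<beta> / 2) * (1/2 + \<beta>)" using beta_pos by (simp add: algebra_simps)
  then have "\<theta> * exp (- \<theta> * a) * (1/2) \<le> \<theta> * exp (- \<theta> * a) * ((1 - \<beta> / 2) * (1/2 + \<beta>))"
    using theta_pos by (intro mult_left_mono) auto
  then show ?thesis using False assms by (cases "a = 0") (auto simp: algebra_simps)
qed

lemma drift_exp_le:
  assumes "0 \<le> a" "0 \<le> b"
  shows "drift lyap_exp rate_exp a b \<le> \<theta> * (- of_bool (a = 0) / 2 + (\<alpha> + \<beta>) * exp (- \<theta> * c) * of_bool (c < a))"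
proof -
  have "drift lyap_exp rate_exp a b \<le> (exp (- \<theta> * a) * (- \<theta> * (1 - \<beta> / 2))) * (1/2 + \<beta> - (\<alpha> + \<beta>) * of_bool (c < a))
      + 0 * (1 - \<epsilon>) + 0 * (lam * (\<integral>s. s\<^sup>2 \<partial>D)) - rate_exp a b"
  proof (rule drift_le[OF service_pair_exp assms])
    fix s :: real assume "0 < s"
    then show "post lyap_exp a b s - lyap_exp a b \<le> (exp (- \<theta> * a) * (- \<theta> * (1 - \<beta> / 2))) * (s * indicator {..<cutoff a} s)
        + 0 * s + 0 * s\<^sup>2"
      using exp_diff_le[of s a] cutoff_le[of a] by (auto simp: post_def lyap_exp_def)
  qed
  then show ?thesis using exp_rate_le[OF assms(1)] by (simp add: rate_exp_def)
qed

text \<open>A product rule: the drift of the exponential times \<open>b\<close>, plus the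
  exponential times the drift of \<open>b\<close>. Long load is total minus short load, so the
  latter drift is negative unless \<open>c < a\<close> or \<open>b = 0\<close>; these two cases give
  the last bracket.\<close>

lemma drift_exp_long_le:
  assumes "0 \<le> a" "0 \<le> b"
  shows "drift lyap_exp_long rate_exp_long a b \<le> \<theta> * b * (- of_bool (a = 0) / 2 + (\<alpha> + \<beta>) * exp (- \<theta> * c) * of_bool (c < a))
     + (\<alpha> * exp (- \<theta> * c) * of_bool (c < a) + of_bool (b = 0) / 2)"
proof -
  let ?v = "exp (- \<theta> * a)" and ?\<sigma> = "1/2 + \<beta> - (\<alpha> + \<beta>) * of_bool (c < a)"
  have "drift lyap_exp_long rate_exp_long a b \<le> (b * (?v * (- \<theta> * (1 - \<beta> / 2))) - ?v) * ?\<sigma>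
      + ?v * (1 - \<epsilon>) + 0 * (lam * (\<integral>s. s\<^sup>2 \<partial>D)) - rate_exp_long a b"
  proof (rule drift_le[OF service_pair_exp_long assms])
    fix s :: real assume s: "0 < s"
    show "post lyap_exp_long a b s - lyap_exp_long a b \<le> (b * (?v * (- \<theta> * (1 - \<beta> / 2))) - ?v) * (s * indicator {..<cutoff a} s)
        + ?v * s + 0 * s\<^sup>2"
    proof (cases "s < cutoff a")
      case True
      then have "b * (exp (- \<theta> * (a + s)) - ?v) \<le> b * (?v * (- \<theta> * (1 - \<beta> / 2)) * s)"
        using exp_diff_le[of s a] cutoff_le[of a] s assms by (intro mult_left_mono) auto
      then show ?thesis using True by (simp add: post_def lyap_exp_long_def algebra_simps)
    qed (simp add: post_def lyap_exp_long_def algebra_simps)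
  qed
  also have "\<dots> = b * (?v * (- \<theta> * (1 - \<beta> / 2)) * ?\<sigma> + of_bool (0 < a) * \<theta> * ?v / 2)
      + ?v * (1/2 - \<epsilon> - \<beta> + (\<alpha> + \<beta>) * of_bool (c < a) - of_bool (0 < b) / 2)"
    by (simp add: rate_exp_long_def field_simps)
  also have "b * (?v * (- \<theta> * (1 - \<beta> / 2)) * ?\<sigma> + of_bool (0 < a) * \<theta> * ?v / 2)
      \<le> b * (\<theta> * (- of_bool (a = 0) / 2 + (\<alpha> + \<beta>) * exp (- \<theta> * c) * of_bool (c < a)))"
    by (intro mult_left_mono exp_rate_le assms)
  also have "?v * (1/2 - \<epsilon> - \<beta> + (\<alpha> + \<beta>) * of_bool (c < a) - of_bool (0 < b) / 2)
      \<le> ?v * (\<alpha> * of_bool (c < a) + of_bool (b = 0) / 2)"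
    using eps_pos beta_pos assms by (intro mult_left_mono) auto
  also have "\<dots> \<le> \<alpha> * exp (- \<theta> * c) * of_bool (c < a) + of_bool (b = 0) / 2"
  proof -
    have "\<alpha> * ?v * of_bool (c < a) \<le> \<alpha> * exp (- \<theta> * c) * of_bool (c < a)"
      using theta_pos alpha_pos by simp
    moreover have "?v * of_bool (b = 0) \<le> 1 * of_bool (b = 0)"
      using theta_pos assms by (intro mult_right_mono) auto
    ultimately show ?thesis by (simp only: distrib_left mult_1 times_divide_eq_right mult.assoc mult.left_commute)
  qed
  finally show ?thesis by (simp add: algebra_simps)
qed

text \<open>The total work is multiplied by the drift
  \<open>\<beta> - (\<alpha> + \<beta>) * 1(c < a)\<close> of the short work, so averaging exchanges
  \<open>W * 1(c < a)\<close> for \<open>\<beta> / (\<alpha> + \<beta>) * W\<close>. Using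
  \<open>a * W\<close> instead of \<open>a * b\<close> keeps
  \<open>- (\<alpha> + \<beta>) * a * 1(c < a)\<close>, which also pays for the short work above
  \<open>c\<close>; and the only \<open>s^2\<close> in its jumps comes from short jobs, where
  \<open>s^2 \<le> m_plus * s\<close>.\<close>

lemma drift_short_total_le:
  assumes "0 \<le> a" "0 \<le> b"
  shows "drift lyap_short_total rate_short_total a b \<le> (a + b) * (\<beta> - (\<alpha> + \<beta>) * of_bool (c < a))
     + (b * of_bool (a = 0) + a * of_bool (b = 0)) / 2 + m_plus"
proof -
  let ?\<sigma> = "1/2 + \<beta> - (\<alpha> + \<beta>) * of_bool (c < a)"
  have "drift lyap_short_total rate_short_total a b \<le> (a + b + m_plus) * ?\<sigma> + a * (1 - \<epsilon>) + 0 * (lam * (\<integral>s. s\<^sup>2 \<partial>D)) - rate_short_total a b"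
  proof (rule drift_le[OF service_pair_short_total assms])
    fix s :: real assume s: "0 < s"
    have "s * s \<le> m_plus * s" if "s < cutoff a" using cutoff_le[of a] s that by (intro mult_right_mono) auto
    then show "post lyap_short_total a b s - lyap_short_total a b \<le> (a + b + m_plus) * (s * indicator {..<cutoff a} s) + a * s + 0 * s\<^sup>2"
      by (auto simp: post_def lyap_short_total_def algebra_simps)
  qed
  moreover have "m_plus * ?\<sigma> \<le> m_plus * 1"
    using alpha_pos beta_le beta_pos m_plus_pos by (intro mult_left_mono) auto
  moreover have "0 \<le> a * \<epsilon>" using assms eps_pos by simp
  ultimately show ?thesis
    using assms by (cases "a = 0"; cases "b = 0") (auto simp: rate_short_total_def algebra_simps add_divide_distrib)
qed

text \<open>The single-server computation at total service rate 1. The cross terms are the service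
  lost when exactly one server is idle while the other holds work.\<close>

lemma drift_total_sq_le:
  assumes "0 \<le> a" "0 \<le> b"
  shows "drift lyap_total_sq rate_total_sq a b \<le> - 2 * \<epsilon> * (a + b) + (b * of_bool (a = 0) + a * of_bool (b = 0))
     + lam * (\<integral>s. s\<^sup>2 \<partial>D)"
proof -
  have "drift lyap_total_sq rate_total_sq a b \<le> 0 * (1/2 + \<beta> - (\<alpha> + \<beta>) * of_bool (c < a)) + (2 * (a + b)) * (1 - \<epsilon>)
     + 1 * (lam * (\<integral>s. s\<^sup>2 \<partial>D)) - rate_total_sq a b"
    by (rule drift_le[OF service_pair_total_sq assms]) (auto simp: post_def lyap_total_sq_def power2_eq_square algebra_simps)
  then show ?thesis
    using assms by (cases "a = 0"; cases "b = 0") (auto simp: rate_total_sq_def algebra_simps)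
qed

lemma drift_neg_total_le:
  assumes "0 \<le> a" "0 \<le> b"
  shows "drift lyap_neg_total rate_neg_total a b \<le> \<epsilon> - of_bool (a = 0) / 2 - of_bool (b = 0) / 2"
proof -
  have "drift lyap_neg_total rate_neg_total a b \<le> 0 * (1/2 + \<beta> - (\<alpha> + \<beta>) * of_bool (c < a)) + (- 1) * (1 - \<epsilon>)
     + 0 * (lam * (\<integral>s. s\<^sup>2 \<partial>D)) - rate_neg_total a b"
    by (rule drift_le[OF service_pair_neg_total assms]) (auto simp: post_def lyap_neg_total_def)
  then show ?thesis using assms by (auto simp: rate_neg_total_def field_simps)
qed

end

section \<open>The combined Lyapunov function\<close>

text \<open>The coefficient \<open>R\<close> of the linear term is self-referential: the weight of
  \<open>lyap_exp_long\<close> grows with \<open>R / \<epsilon>\<close>, so its error contains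
  \<open>R\<close> again. With \<open>d = \<delta> / \<epsilon> \<le> 1\<close> this error is at
  most \<open>(K + 4 * r) * (1 + d) * d / 2 \<le> (K + 4 * r) * d\<close>, the room left by the
  factor \<open>1 + d\<close>; the remaining \<open>2 * e\<close> fits into the spare
  \<open>2 * r\<close>.\<close>

lemma linear_coefficient_le:
  fixes K r e s \<epsilon> \<delta> :: real
  assumes "0 \<le> K" "0 \<le> e" "e \<le> r" "0 < \<delta>" "\<delta> \<le> \<epsilon>" "e * s \<le> \<delta> / 2"
  shows "K + 2 * r + (s * ((K + 4 * r) * (1 + \<delta> / \<epsilon>)) + 2 * \<epsilon>) * e / \<epsilon> \<le> (K + 4 * r) * (1 + \<delta> / \<epsilon>)"
proof -
  define d where "d = \<delta> / \<epsilon>"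
  have eps: "0 < \<epsilon>" using assms by linarith
  have d: "0 \<le> d" "d \<le> 1" using assms by (auto simp: d_def)
  have "e * s / \<epsilon> \<le> d / 2" using assms(6) eps by (simp add: d_def field_simps)
  then have "(K + 4 * r) * (1 + d) * (e * s / \<epsilon>) \<le> (K + 4 * r) * (1 + d) * (d / 2)"
    using assms d by (intro mult_left_mono mult_nonneg_nonneg) auto
  moreover have "(K + 4 * r) * ((1 + d) * (d / 2)) \<le> (K + 4 * r) * d"
  proof (intro mult_left_mono)
    have "d * d \<le> d * 1" using d by (intro mult_left_mono) auto
    then show "(1 + d) * (d / 2) \<le> d" by (simp add: algebra_simps add_divide_distrib)
  qed (use assms in auto)
  moreover have "(s * ((K + 4 * r) * (1 + d)) + 2 * \<epsilon>) * e / \<epsilon> = (K + 4 * r) * (1 + d) * (e * s / \<epsilon>) + 2 * e"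
    using eps by (simp add: field_simps)
  ultimately show ?thesis using assms unfolding d_def[symmetric] by (simp add: algebra_simps)
qed

text \<open>Budget in multiples of \<open>X\<close>: 18 and 9/2 from
  \<open>H * 2 * L / \<beta>\<close> and \<open>H / \<beta>\<close>, 13/2 from
  \<open>H * t2 / 2\<close>, 4 from \<open>4 * L / \<beta>\<close>, 1/2 from \<open>2 / s\<close>,
  and 3/2 from the overshoot quotient, 35 in all.\<close>

lemma constant_le:
  fixes \<alpha> \<beta> \<epsilon> \<delta> K L e X :: real
  defines "s \<equiv> \<alpha> + \<beta>" and "r \<equiv> \<beta> / (\<alpha> + \<beta>)"
  defines "t1 \<equiv> \<beta> / (\<alpha>\<^sup>2 * (\<alpha> + \<beta>))" and "t2 \<equiv> sqrt (\<beta> / (\<alpha>\<^sup>2 * \<epsilon> * (\<alpha> + \<beta>)))"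
    and "t3 \<equiv> L / (\<beta> * (\<alpha> + \<beta>))"
  defines "H \<equiv> (K + 4 * r) * (1 + \<delta> / \<epsilon>) + 2 * \<epsilon> / s"
  assumes a: "0 < \<alpha>" "\<alpha> \<le> 1/2" and b: "0 < \<beta>" "\<beta> \<le> 1/2" and e: "\<epsilon> \<le> 1/2"
    and d: "0 < \<delta>" "\<delta> \<le> \<epsilon>" "2 * \<delta> \<le> \<beta>" and K: "0 \<le> K" "K \<le> 2" and L: "2 \<le> L"
    and e_eq: "e = (2 * \<beta> * \<delta> / 3)\<^sup>2"
    and X: "t1 \<le> X" "t2 \<le> X" "t3 \<le> X"
  shows "2 / s + (2 * L / \<beta> + 1 / \<beta> + t2 / 2) * H + 4 * L / \<beta>
      + ((1/2 + 3 / (8 * \<alpha>)) * (H / (12 * \<epsilon> * \<alpha> * t2)) + H * e * \<alpha> / (\<beta> * \<epsilon>)) * r / (1 - e) \<le> 44 * X"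
proof -
  have eps: "0 < \<epsilon>" and s0: "0 < s" "s \<le> 1" using a b d by (auto simp: s_def)
  have r: "r = \<beta> / s" by (simp add: r_def s_def)
  have r01: "0 < r" "r \<le> 1" using a b by (auto simp: r_def)
  have t2sq: "t2\<^sup>2 = \<beta> / (\<alpha>\<^sup>2 * \<epsilon> * s)" and t20: "0 < t2"
    using a b eps s0 by (auto simp: t2_def s_def)
  have t3s: "t3 = L / (\<beta> * s)" and t1s: "t1 = \<beta> / (\<alpha>\<^sup>2 * s)" by (auto simp: t3_def t1_def s_def)
  have t30: "0 < t3" using L b s0 by (simp add: t3s)
  have X0: "0 < X" using t30 X by linarith
  have bs: "1 / (\<beta> * s) \<le> X / 2"
  proof -
    have "2 * (1 / (\<beta> * s)) \<le> L * (1 / (\<beta> * s))" using L b s0 by (intro mult_right_mono) auto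
    then show ?thesis using X by (simp add: t3s)
  qed
  have s1: "1 / s \<le> X / 4"
  proof -
    have "1 / s = \<beta> * (1 / (\<beta> * s))" using b by simp
    also have "\<dots> \<le> 1/2 * (X / 2)" using b s0 bs by (intro mult_mono) auto
    finally show ?thesis by simp
  qed
  have d1: "\<delta> / \<epsilon> \<le> 1" using d eps by simp
  have R12: "(K + 4 * r) * (1 + \<delta> / \<epsilon>) \<le> (2 + 4 * 1) * (1 + 1)"
    using K r01 d1 d eps by (intro mult_mono add_mono) auto
  \<comment> \<open>Two bounds on the same factor: the absolute 12 is combined with
    \<open>t2\<close>, whereas \<open>8 / s\<close> is combined with \<open>L / \<beta>\<close> and
    \<open>1 / \<beta>\<close>, where the extra \<open>1 / s\<close> completes
    \<open>t3\<close>.\<close>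
  have R8: "(K + 4 * r) * (1 + \<delta> / \<epsilon>) \<le> 8 / s"
  proof -
    have "K * s \<le> 2 * 1" using K s0 by (intro mult_mono) auto
    then have "K \<le> 2 / s" using s0 by (simp add: pos_le_divide_eq)
    moreover have "4 * \<beta> / s \<le> 2 / s" using b s0 by (intro divide_right_mono) auto
    ultimately have "K + 4 * r \<le> 4 / s" by (simp add: r add_divide_distrib[symmetric])
    then have "(K + 4 * r) * (1 + \<delta> / \<epsilon>) \<le> 4 / s * (1 + 1)"
      using K r01 d1 d eps s0 by (intro mult_mono) auto
    then show ?thesis by simp
  qed
  have R0: "0 \<le> (K + 4 * r) * (1 + \<delta> / \<epsilon>)" using K r01 d eps by simp
  have H0: "0 \<le> H" using R0 eps s0 by (simp add: H_def)
  have H9: "H \<le> 9 / s"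
  proof -
    have "2 * \<epsilon> / s \<le> 1 / s" using e s0 by (intro divide_right_mono) auto
    moreover have "8 / s + 1 / s = 9 / s" by (simp add: add_divide_distrib[symmetric])
    ultimately show ?thesis using R8 by (simp add: H_def)
  qed
  \<comment> \<open>Bounded by half the geometric mean of \<open>t1\<close> and \<open>t3\<close>,
    since \<open>t1 * t3 = L / (\<alpha>\<^sup>2 * s\<^sup>2)\<close> in the notation of the
    code.\<close>
  have et2: "\<epsilon> * t2 / s \<le> X / 2"
  proof (rule power2_le_imp_le)
    have "(\<epsilon> * t2 / s)\<^sup>2 = \<epsilon>\<^sup>2 * (\<beta> / (\<alpha>\<^sup>2 * \<epsilon> * s)) / s\<^sup>2"
      by (simp add: power_mult_distrib power_divide t2sq)
    also have "\<dots> = \<epsilon> * r * (1 / (\<alpha>\<^sup>2 * s\<^sup>2))"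
      using eps by (simp add: r power2_eq_square)
    also have "\<dots> \<le> 1/2 * 1 * (1 / (\<alpha>\<^sup>2 * s\<^sup>2))"
      using r01 e eps by (intro mult_mono) auto
    also have "\<dots> = 2 / 4 * (1 / (\<alpha>\<^sup>2 * s\<^sup>2))" by simp
    also have "\<dots> \<le> L / 4 * (1 / (\<alpha>\<^sup>2 * s\<^sup>2))" using L by (intro mult_right_mono) auto
    also have "\<dots> = t1 * t3 / 4" using b by (simp add: t1s t3s power2_eq_square)
    also have "\<dots> \<le> X * X / 4" using X t30 X0 by (intro divide_right_mono mult_mono) auto
    finally show "(\<epsilon> * t2 / s)\<^sup>2 \<le> (X / 2)\<^sup>2" by (simp add: power2_eq_square)
  qed (use X0 in simp)
  have Ht2: "H * t2 \<le> 13 * X"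
  proof -
    have "(K + 4 * r) * (1 + \<delta> / \<epsilon>) * t2 \<le> 12 * X" using R12 t20 X by (intro mult_mono) auto
    moreover have "H * t2 = (K + 4 * r) * (1 + \<delta> / \<epsilon>) * t2 + 2 * (\<epsilon> * t2 / s)"
      by (simp add: H_def algebra_simps)
    ultimately show ?thesis using et2 by linarith
  qed
  have HL: "H * (2 * L / \<beta>) \<le> 18 * X"
  proof -
    have "H * (2 * L / \<beta>) \<le> 9 / s * (2 * L / \<beta>)" using H9 L b by (intro mult_right_mono) auto
    also have "\<dots> = 18 * t3" by (simp add: t3s)
    finally show ?thesis using X by linarith
  qed
  have Hb: "H * (1 / \<beta>) \<le> 9/2 * X"
  proof -
    have "H * (1 / \<beta>) \<le> 9 / s * (1 / \<beta>)" using H9 b by (intro mult_right_mono) auto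
    also have "\<dots> = 9 * (1 / (\<beta> * s))" by simp
    finally show ?thesis using bs by linarith
  qed
  have Lb: "4 * L / \<beta> \<le> 4 * X"
  proof -
    have "L / \<beta> \<le> t3" using s0 b L by (simp add: t3s field_simps mult_left_le)
    then show ?thesis using X by simp
  qed
  have db: "\<beta> * \<delta> \<le> 1/8"
  proof -
    have "\<beta> * \<delta> \<le> 1/2 * (1/4)" using b d by (intro mult_mono) auto
    then show ?thesis by simp
  qed
  have e_eps: "e / \<epsilon> \<le> \<beta> / 18" and e2: "e \<le> 1/2" and e0: "0 \<le> e"
  proof -
    have "\<beta> * \<delta> * (\<beta> * \<delta>) \<le> 1/8 * (\<beta> * \<epsilon>)" using db b d by (intro mult_mono) auto
    then show "e / \<epsilon> \<le> \<beta> / 18" using eps by (simp add: e_eq power2_eq_square field_simps)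
    have "\<beta> * \<delta> * (\<beta> * \<delta>) \<le> 1/8 * (1/8)" using db b d by (intro mult_mono) auto
    then show "e \<le> 1/2" by (simp add: e_eq power2_eq_square)
  qed (simp add: e_eq)
  \<comment> \<open>Here the value of \<open>t2\<close> pays off: up to a constant the expression is
    \<open>H * t2\<^sup>2 / t2\<close>, so the overshoot cost has the same order
    \<open>H * t2\<close> as the idle cost of Young's inequality.\<close>
  have J1: "(1/2 + 3 / (8 * \<alpha>)) * (H / (12 * \<epsilon> * \<alpha> * t2)) * r \<le> 13 * 5 / 96 * X"
  proof -
    have "1/2 + 3 / (8 * \<alpha>) \<le> 5 / (8 * \<alpha>)" using a by (simp add: field_simps)
    then have "(1/2 + 3 / (8 * \<alpha>)) * (H / (12 * \<epsilon> * \<alpha> * t2) * r) \<le> 5 / (8 * \<alpha>) * (H / (12 * \<epsilon> * \<alpha> * t2) * r)"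
      using H0 eps a t20 r01 by (intro mult_right_mono) auto
    also have "\<dots> = 5 / 96 * (H * (\<beta> / (\<alpha>\<^sup>2 * \<epsilon> * s)) / t2)"
      by (simp add: r power2_eq_square)
    also have "\<dots> = 5 / 96 * (H * t2)" using t20 unfolding t2sq[symmetric] by (simp add: power2_eq_square)
    finally show ?thesis using Ht2 by (simp add: mult.assoc)
  qed
  have J2: "H * e * \<alpha> / (\<beta> * \<epsilon>) * r \<le> X / 16"
  proof -
    have "H * e * \<alpha> / (\<beta> * \<epsilon>) * r = H * (e / \<epsilon>) * (\<alpha> / s)" using b by (simp add: r)
    also have "\<dots> \<le> 9 / s * (\<beta> / 18) * 1"
      using H9 e_eps H0 e0 eps s0 a b by (intro mult_mono mult_nonneg_nonneg) (auto simp: s_def)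
    also have "\<dots> = \<beta> / 2 * (1 / s)" by simp
    also have "\<dots> \<le> 1/4 * (X / 4)" using s1 b s0 by (intro mult_mono) auto
    finally show ?thesis by simp
  qed
  let ?J = "((1/2 + 3 / (8 * \<alpha>)) * (H / (12 * \<epsilon> * \<alpha> * t2)) + H * e * \<alpha> / (\<beta> * \<epsilon>)) * r"
  have J: "?J / (1 - e) \<le> 3/2 * X"
  proof -
    have "?J \<le> 3/4 * X" using J1 J2 X0 by (subst distrib_right) linarith
    also have "\<dots> = 3/2 * X * (1/2)" by simp
    also have "\<dots> \<le> 3/2 * X * (1 - e)" using e2 X0 by (intro mult_left_mono) auto
    finally show ?thesis using e2 by (simp add: pos_divide_le_eq)
  qed
  have "(2 * L / \<beta> + 1 / \<beta> + t2 / 2) * H = H * (2 * L / \<beta>) + H * (1 / \<beta>) + H * t2 / 2"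
    by (simp add: algebra_simps add_divide_distrib)
  moreover have "2 / s = 2 * (1 / s)" by simp
  ultimately show ?thesis using HL Hb Ht2 Lb J s1 X0 by linarith
qed

text \<open>Young's inequality with weight \<open>1 / (m * t)\<close>, on the event that the long server is idle.\<close>

lemma idle_cross_le:
  fixes a c m t :: real
  assumes "0 < m" "0 < t"
  shows "a * of_bool P \<le> (c + m * t / 2) * of_bool P + (max 0 (a - c))\<^sup>2 * of_bool (c < a) / (2 * (m * t))"
proof -
  define u where "u = max 0 (a - c)"
  have mt: "0 < m * t" using assms by simp
  have "2 * u * (m * t) \<le> u * u + (m * t) * (m * t)"
    using sum_squares_bound[of u "m * t"] by (simp add: power2_eq_square)
  then have "u \<le> u * u / (2 * (m * t)) + m * t / 2"
    using mt assms by (simp add: field_simps)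
  moreover have "a \<le> c + u" "u\<^sup>2 * of_bool (c < a) = u\<^sup>2" by (auto simp: u_def)
  moreover have "0 \<le> u\<^sup>2 / (2 * (m * t))" using mt by simp
  ultimately show ?thesis unfolding u_def[symmetric] by (cases P) (auto simp: power2_eq_square)
qed

section \<open>Choice of the coefficients\<close>

context card_drift
begin

text \<open>What remains besides the M/G/1 term: the bounded short jumps in \<open>a * W\<close>,
  the idle budget of \<open>- W\<close> (the term with \<open>H\<close>), the short work up to
  \<open>c\<close>, and the weight of \<open>lyap_short\<close> times its drift
  \<open>\<beta>\<close>. \<open>H\<close> is \<open>2 * \<epsilon>\<close> times the coefficient of
  the idle cross terms.\<close>

definition lyapunov_bound where
  "lyapunov_bound K \<delta> t2 e = (let H = (K + 4 * (\<beta> / (\<alpha> + \<beta>))) * (1 + \<delta> / \<epsilon>) + 2 * \<epsilon> / (\<alpha> + \<beta>) in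
     2 * m_plus / (\<alpha> + \<beta>) + (c + m_plus / \<beta> + m_plus * t2 / 2) * H + 2 * c
     + m_plus * ((1/2 + 3 / (8 * \<alpha>)) * (H / (12 * \<epsilon> * \<alpha> * t2)) + H * e * \<alpha> / (\<beta> * \<epsilon>)) * (\<beta> / (\<alpha> + \<beta>)) / (1 - e))"

text \<open>Hypothesis \<open>W\<close> makes the coefficient of the total work nonpositive: the
  \<open>- R * (a + b)\<close> from \<open>W^2\<close> must outweigh the cost, the share coming from
  \<open>a * W\<close>, and the error of size \<open>e\<close>. The Young weight \<open>t2\<close>
  is kept free, to be balanced afterwards.\<close>

lemma lyapunov_exists:
  fixes K \<delta> t2 :: real
  defines "e \<equiv> exp (- \<theta> * c)" and "R \<equiv> (K + 4 * (\<beta> / (\<alpha> + \<beta>))) * (1 + \<delta> / \<epsilon>)"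
  assumes K: "0 \<le> K" and \<delta>: "0 < \<delta>" and t2: "0 < t2" and e1: "e < 1"
    and W: "K + 2 * (\<beta> / (\<alpha> + \<beta>)) + ((\<alpha> + \<beta>) * R + 2 * \<epsilon>) * e / \<epsilon> \<le> R"
  obtains G dG C where "service_pair lam G dG"
    "\<And>a b. 0 \<le> a \<Longrightarrow> 0 \<le> b \<Longrightarrow> - C \<le> G a b"
    "\<And>a b. 0 \<le> a \<Longrightarrow> 0 \<le> b \<Longrightarrow> 2 * a + K * b + 2 * b * of_bool (c < a) + drift G dG a b
       \<le> R * (lam * (\<integral>s. s\<^sup>2 \<partial>D) / (2 * \<epsilon>)) + lyapunov_bound K \<delta> t2 e"
proof -
  \<comment> \<open>The coefficients are chosen so that in the combined drift every term in \<open>b * 1(a = 0)\<close>,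
    \<open>a * 1(b = 0)\<close>, \<open>(excess a)\<^sup>2\<close>, \<open>excess a\<close> and \<open>1(c < a)\<close> cancels.\<close>
  define s where "s = \<alpha> + \<beta>"
  define A where "A = R / (2 * \<epsilon>)"
  \<comment> \<open>Total coefficient of the idle cross terms: \<open>A\<close> from
    \<open>W^2\<close> and \<open>1 / s\<close> from \<open>a * W\<close>.\<close>
  define k where "k = A + 1 / s"
  \<comment> \<open>The charge for long-server idleness in units of \<open>k\<close>:
    \<open>c + m_plus * t2 / 2\<close> from Young's inequality and
    \<open>m_plus / \<beta> = 1 / \<theta>\<close> from the idle term of
    \<open>lyap_exp_long\<close>.\<close>
  define q where "q = c + m_plus / \<beta> + m_plus * t2 / 2"
  define C3 where "C3 = k / (6 * \<alpha> * (m_plus * t2))"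
  define C2 where "C2 = 3/4 * m_plus * C3 / \<alpha>"
  define J where "J = C3 * m_plus\<^sup>2 / 2 + C2 * m_plus / 2 + 2 * k / \<theta> * e * \<alpha>"
  \<comment> \<open>\<open>lyap_short\<close> contributes \<open>- s\<close> on
    \<open>c < a\<close>, and \<open>lyap_exp\<close>, added to remove its idle term, gives back
    \<open>s * e\<close>; hence the divisor.\<close>
  define Ca where "Ca = J / (s * (1 - e))"
  have e0: "0 < e" by (simp add: e_def)
  have s0: "0 < s" using alpha_pos beta_pos by (simp add: s_def)
  have R0: "0 < R" using K \<delta> eps_pos alpha_pos beta_pos
    unfolding R_def by (intro mult_pos_pos add_nonneg_pos add_pos_pos divide_pos_pos) auto
  have A0: "0 < A" using R0 eps_pos by (simp add: A_def)
  have k0: "0 < k" using A0 s0 by (simp add: k_def add_pos_pos)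
  have q0: "0 < q" using c_nonneg m_plus_pos beta_pos t2 by (simp add: q_def add_nonneg_pos)
  have C30: "0 \<le> C3" using k0 alpha_pos m_plus_pos t2 by (simp add: C3_def)
  have C20: "0 \<le> C2" using C30 alpha_pos m_plus_pos by (simp add: C2_def)
  have J0: "0 \<le> J" using C30 C20 alpha_pos m_plus_pos e0 k0 theta_pos by (simp add: J_def)
  have Ca0: "0 \<le> Ca" using J0 s0 e1 by (simp add: Ca_def)
  define G where "G = (\<lambda>a b. 1 * (1 * (Ca * lyap_short a b + C2 * lyap_excess_sq a b) + 1 * (C3 * lyap_excess_cube a b + (Ca / \<theta>) * lyap_exp a b))
     + 1 * (1 * ((2 * k / \<theta>) * lyap_exp_long a b + (2 / s) * lyap_short_total a b) + 1 * (A * lyap_total_sq a b + (2 * q * k) * lyap_neg_total a b)))"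
  define dG where "dG = (\<lambda>a b. 1 * (1 * (Ca * rate_short a b + C2 * rate_excess_sq a b) + 1 * (C3 * rate_excess_cube a b + (Ca / \<theta>) * rate_exp a b))
     + 1 * (1 * ((2 * k / \<theta>) * rate_exp_long a b + (2 / s) * rate_short_total a b) + 1 * (A * rate_total_sq a b + (2 * q * k) * rate_neg_total a b)))"
  note sp12 = service_pair_lincomb[OF service_pair_short service_pair_excess_sq lam_pos, of Ca C2]
  note sp34 = service_pair_lincomb[OF service_pair_excess_cube service_pair_exp lam_pos, of C3 "Ca / \<theta>"]
  note sp56 = service_pair_lincomb[OF service_pair_exp_long service_pair_short_total lam_pos, of "2 * k / \<theta>" "2 / s"]
  note sp78 = service_pair_lincomb[OF service_pair_total_sq service_pair_neg_total lam_pos, of A "2 * q * k"]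
  note sp1234 = service_pair_lincomb[OF sp12 sp34 lam_pos, of 1 1]
  note sp5678 = service_pair_lincomb[OF sp56 sp78 lam_pos, of 1 1]
  have spG: "service_pair lam G dG"
    unfolding G_def dG_def by (rule service_pair_lincomb[OF sp1234 sp5678 lam_pos])
  have dr: "drift G dG a b = Ca * drift lyap_short rate_short a b + C2 * drift lyap_excess_sq rate_excess_sq a b + C3 * drift lyap_excess_cube rate_excess_cube a b
      + Ca / \<theta> * drift lyap_exp rate_exp a b + 2 * k / \<theta> * drift lyap_exp_long rate_exp_long a b + 2 / s * drift lyap_short_total rate_short_total a b
      + A * drift lyap_total_sq rate_total_sq a b + 2 * q * k * drift lyap_neg_total rate_neg_total a b" if "0 \<le> a" "0 \<le> b" for a b
    unfolding G_def dG_def drift_lincomb[OF sp1234 sp5678 that] drift_lincomb[OF sp12 sp34 that]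
      drift_lincomb[OF sp56 sp78 that] drift_lincomb[OF service_pair_short service_pair_excess_sq that] drift_lincomb[OF service_pair_excess_cube service_pair_exp that]
      drift_lincomb[OF service_pair_exp_long service_pair_short_total that] drift_lincomb[OF service_pair_total_sq service_pair_neg_total that] by simp
  show ?thesis
  proof (rule that[OF spG])
    fix a b :: real assume ab: "0 \<le> a" "0 \<le> b"
    let ?u = "excess a"
    have 1: "0 \<le> Ca * lyap_short a b" using Ca0 ab by (simp add: lyap_short_def)
    have 2: "C2 * (- m_plus\<^sup>2) \<le> C2 * lyap_excess_sq a b"
    proof (intro mult_left_mono C20)
      have "0 \<le> (?u - m_plus / 2)\<^sup>2" by simp
      also have "\<dots> = ?u\<^sup>2 - m_plus * ?u + m_plus\<^sup>2 / 4" by (simp add: power2_diff power_divide)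
      finally show "- m_plus\<^sup>2 \<le> lyap_excess_sq a b"
        using zero_le_power2[of m_plus] unfolding lyap_excess_sq_def by linarith
    qed
    have 3: "C3 * (- (m_plus ^ 3)) \<le> C3 * lyap_excess_cube a b"
    proof (intro mult_left_mono C30)
      show "- (m_plus ^ 3) \<le> lyap_excess_cube a b"
      proof (cases "?u \<le> m_plus")
        case True
        then have "m_plus\<^sup>2 * ?u \<le> m_plus\<^sup>2 * m_plus" by (intro mult_left_mono) auto
        moreover have "0 \<le> ?u ^ 3" by simp
        ultimately show ?thesis unfolding lyap_excess_cube_def power2_eq_square power3_eq_cube by linarith
      next
        case False
        then have "m_plus\<^sup>2 * ?u \<le> ?u\<^sup>2 * ?u" using m_plus_pos by (intro mult_right_mono power_mono) auto
        moreover have "0 \<le> m_plus ^ 3" using m_plus_pos by simp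
        ultimately show ?thesis unfolding lyap_excess_cube_def power2_eq_square power3_eq_cube by linarith
      qed
    qed
    have 4: "0 \<le> Ca / \<theta> * lyap_exp a b" using Ca0 theta_pos by (simp add: lyap_exp_def)
    have 5: "0 \<le> 2 * k / \<theta> * lyap_exp_long a b" using k0 theta_pos ab by (simp add: lyap_exp_long_def)
    have 6: "0 \<le> 2 / s * lyap_short_total a b" using s0 ab by (simp add: lyap_short_total_def)
    \<comment> \<open>Completing the square: the negative linear term is dominated by
      \<open>A * W^2\<close>.\<close>
    have 7: "- (q * k)\<^sup>2 / A \<le> A * lyap_total_sq a b + 2 * q * k * lyap_neg_total a b"
    proof -
      have "0 \<le> (A * (a + b) - q * k)\<^sup>2 / A" using A0 by simp
      also have "\<dots> = A * lyap_total_sq a b + 2 * q * k * lyap_neg_total a b + (q * k)\<^sup>2 / A"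
        using A0 by (simp add: lyap_total_sq_def lyap_neg_total_def power2_diff power_mult_distrib field_simps power2_eq_square)
      finally show ?thesis by simp
    qed
    show "- (C2 * m_plus\<^sup>2 + C3 * m_plus ^ 3 + (q * k)\<^sup>2 / A) \<le> G a b"
      unfolding G_def using 1 2 3 4 5 6 7 by simp
  next
    fix a b :: real assume ab: "0 \<le> a" "0 \<le> b"
    define I where "I = (of_bool (c < a) :: real)"
    define z where "z = (of_bool (a = 0) :: real)"
    define x where "x = (of_bool (b = 0) :: real)"
    define u where "u = excess a"
    define ES2 where "ES2 = lam * (\<integral>s. s\<^sup>2 \<partial>D)"
    have I: "0 \<le> I" "I \<le> 1" and z: "0 \<le> z" and x: "0 \<le> x" by (auto simp: I_def z_def x_def)
    note defs = I_def[symmetric] z_def[symmetric] x_def[symmetric] u_def[symmetric] s_def[symmetric]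
      e_def[symmetric] ES2_def[symmetric]
    have D1: "Ca * drift lyap_short rate_short a b \<le> Ca * (\<beta> - s * I + z / 2)"
      using drift_short_le[OF ab] Ca0 unfolding defs by (intro mult_left_mono) auto
    have D2: "C2 * drift lyap_excess_sq rate_excess_sq a b \<le> C2 * (I * (- 2 * \<alpha> * u + m_plus / 2))"
      using drift_excess_sq_le[OF ab] C20 unfolding defs by (intro mult_left_mono) auto
    have D3: "C3 * drift lyap_excess_cube rate_excess_cube a b \<le> C3 * (I * (- 3 * \<alpha> * u\<^sup>2 + 3/2 * m_plus * u + m_plus\<^sup>2 / 2))"
      using drift_excess_cube_le[OF ab] C30 unfolding defs by (intro mult_left_mono) auto
    have "Ca / \<theta> * drift lyap_exp rate_exp a b \<le> Ca / \<theta> * (\<theta> * (- z / 2 + s * e * I))"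
      using drift_exp_le[OF ab] Ca0 theta_pos unfolding defs by (intro mult_left_mono) auto
    then have D4: "Ca / \<theta> * drift lyap_exp rate_exp a b \<le> Ca * (- z / 2 + s * e * I)" using theta_pos by simp
    have "2 * k / \<theta> * drift lyap_exp_long rate_exp_long a b \<le> 2 * k / \<theta> * (\<theta> * b * (- z / 2 + s * e * I) + (\<alpha> * e * I + x / 2))"
      using drift_exp_long_le[OF ab] k0 theta_pos unfolding defs by (intro mult_left_mono) auto
    also have "\<dots> = 2 * k * b * (- z / 2 + s * e * I) + 2 * k / \<theta> * e * \<alpha> * I + k * (m_plus / \<beta>) * x"
      using theta_pos m_plus_pos beta_pos by (simp add: field_simps) (simp add: \<theta>_def field_simps)
    finally have D5: "2 * k / \<theta> * drift lyap_exp_long rate_exp_long a b \<le> \<dots>" .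
    have D6: "2 / s * drift lyap_short_total rate_short_total a b \<le> 2 / s * ((a + b) * (\<beta> - s * I) + (b * z + a * x) / 2 + m_plus)"
      using drift_short_total_le[OF ab] s0 unfolding defs by (intro mult_left_mono) auto
    have D7: "A * drift lyap_total_sq rate_total_sq a b \<le> A * (- 2 * \<epsilon> * (a + b) + (b * z + a * x) + ES2)"
      using drift_total_sq_le[OF ab] A0 unfolding defs by (intro mult_left_mono) auto
    have D8: "2 * q * k * drift lyap_neg_total rate_neg_total a b \<le> 2 * q * k * (\<epsilon> - z / 2 - x / 2)"
      using drift_neg_total_le[OF ab] q0 k0 unfolding defs by (intro mult_left_mono) auto
    have D6': "2 / s * ((a + b) * (\<beta> - s * I) + (b * z + a * x) / 2 + m_plus)
       = 2 * (\<beta> / s) * (a + b) - 2 * (a + b) * I + (b * z + a * x) * (1 / s) + 2 * m_plus / s"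
      using s0 by (simp add: field_simps)
    have D7': "A * (- 2 * \<epsilon> * (a + b) + (b * z + a * x) + ES2)
       = (b * z + a * x) * A + R * (ES2 / (2 * \<epsilon>)) - R * (a + b)"
      using eps_pos by (simp add: A_def field_simps)
    \<comment> \<open>Only this cross term needs Young's inequality; \<open>k * (b * z)\<close> is
      cancelled exactly by \<open>lyap_exp_long\<close>, see \<open>e5\<close>.\<close>
    have cross: "k * (a * x) \<le> k * ((c + m_plus * t2 / 2) * x + u\<^sup>2 * I / (2 * (m_plus * t2)))"
      using idle_cross_le[OF m_plus_pos t2, of a "b = 0" c] k0 unfolding defs by (intro mult_left_mono) auto
    have cross': "k * ((c + m_plus * t2 / 2) * x + u\<^sup>2 * I / (2 * (m_plus * t2)))
       = q * k * x - k * (m_plus / \<beta>) * x + 3 * \<alpha> * C3 * u\<^sup>2 * I"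
      using alpha_pos m_plus_pos t2 by (simp add: q_def C3_def field_simps)
    have C2': "2 * \<alpha> * C2 = 3/2 * m_plus * C3" using alpha_pos by (simp add: C2_def)
    have CJ: "Ca * s * (1 - e) = J" using s0 e1 by (simp add: Ca_def)
    have qkz: "0 \<le> q * k * z" using q0 k0 z by simp
    \<comment> \<open>Above \<open>c\<close> the cost \<open>2 * a\<close> has been cancelled by
      \<open>a * W\<close>, so only short work of at most \<open>c\<close> remains.\<close>
    have aI: "2 * a * (1 - I) \<le> 2 * c" using ab c_nonneg by (auto simp: I_def)
    have "2 * k * s * e = (s * R + 2 * \<epsilon>) * e / \<epsilon>"
      using s0 eps_pos by (simp add: k_def A_def field_simps)
    with W have W': "K + 2 * (\<beta> / s) + 2 * k * s * e - R \<le> 0" unfolding s_def by linarith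
    have lin: "K * b + 2 * (\<beta> / s) * (a + b) + 2 * k * b * (s * e * I) - R * (a + b) \<le> 0"
    proof -
      have "K * b \<le> K * (a + b)" using K ab by (intro mult_left_mono) auto
      moreover have "2 * k * s * e * (b * I) \<le> 2 * k * s * e * (a + b)"
        using k0 s0 e0 ab I mult_left_mono[of I 1 b] by (intro mult_left_mono) auto
      moreover have "(K + 2 * (\<beta> / s) + 2 * k * s * e - R) * (a + b) \<le> 0"
        using W' ab by (intro mult_nonpos_nonneg) auto
      ultimately show ?thesis by (simp add: algebra_simps)
    qed
    have C2u: "C2 * (I * (- 2 * \<alpha> * u + m_plus / 2)) = C2 * m_plus / 2 * I - 3/2 * m_plus * C3 * u * I"
      using C2' by (simp add: algebra_simps)
    have "2 * a + K * b + 2 * b * I + drift G dG a b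
       \<le> 2 * c + 2 * m_plus / s + R * (ES2 / (2 * \<epsilon>)) + 2 * q * k * \<epsilon> + Ca * \<beta>"
    proof -
      have kbz: "(b * z + a * x) * (1 / s) + (b * z + a * x) * A = k * (b * z) + k * (a * x)"
        by (simp add: k_def algebra_simps)
      have e5: "2 * k * b * (- z / 2 + s * e * I) = 2 * k * b * (s * e * I) - k * (b * z)"
        by (simp add: algebra_simps)
      have e8: "2 * q * k * (\<epsilon> - z / 2 - x / 2) = 2 * q * k * \<epsilon> - q * k * z - q * k * x"
        by (simp add: algebra_simps)
      have e3: "C3 * (I * (- 3 * \<alpha> * u\<^sup>2 + 3/2 * m_plus * u + m_plus\<^sup>2 / 2))
         = 3/2 * m_plus * C3 * u * I + C3 * m_plus\<^sup>2 / 2 * I - 3 * \<alpha> * C3 * u\<^sup>2 * I"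
        by (simp add: algebra_simps)
      have e14: "Ca * (\<beta> - s * I + z / 2) + Ca * (- z / 2 + s * e * I) = Ca * \<beta> - Ca * s * (1 - e) * I"
        by (simp add: algebra_simps)
      have eJ: "J * I = C3 * m_plus\<^sup>2 / 2 * I + C2 * m_plus / 2 * I + 2 * k / \<theta> * e * \<alpha> * I"
        by (simp add: J_def algebra_simps)
      have eI: "2 * a + 2 * b * I - 2 * (a + b) * I = 2 * a * (1 - I)" by (simp add: algebra_simps)
      show ?thesis
        using D1 D2 D3 D4 D5 D6 D7 D8 cross aI lin qkz kbz e5 e8 e3 e14 eJ eI
        unfolding dr[OF ab] D6' D7' cross' C2u CJ by linarith
    qed
    also have "\<dots> = R * (ES2 / (2 * \<epsilon>)) + lyapunov_bound K \<delta> t2 e"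
    proof -
      define H where "H = R + 2 * \<epsilon> / s"
      have H_eq: "H = (K + 4 * (\<beta> / (\<alpha> + \<beta>))) * (1 + \<delta> / \<epsilon>) + 2 * \<epsilon> / (\<alpha> + \<beta>)"
        by (simp add: H_def R_def s_def)
      have kH: "k = H / (2 * \<epsilon>)" using eps_pos s0 by (simp add: k_def A_def H_def field_simps)
      \<comment> \<open>The \<open>\<epsilon>\<close> in the drift of \<open>- W\<close> cancels the
        \<open>1 / \<epsilon>\<close> hidden in \<open>k\<close>.\<close>
      have qk: "2 * q * k * \<epsilon> = q * H" using eps_pos by (simp add: kH)
      have "J = m_plus * ((1/2 + 3 / (8 * \<alpha>)) * (H / (12 * \<epsilon> * \<alpha> * t2)) + H * e * \<alpha> / (\<beta> * \<epsilon>))"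
        using alpha_pos m_plus_pos t2 eps_pos beta_pos
        by (simp add: J_def C2_def C3_def kH \<theta>_def power2_eq_square field_simps)
      then have "Ca * \<beta> = m_plus * ((1/2 + 3 / (8 * \<alpha>)) * (H / (12 * \<epsilon> * \<alpha> * t2)) + H * e * \<alpha> / (\<beta> * \<epsilon>)) * (\<beta> / s) / (1 - e)"
        by (simp add: Ca_def)
      then show ?thesis
        unfolding lyapunov_bound_def Let_def H_eq[symmetric]
        unfolding s_def[symmetric] q_def[symmetric] qk
        by linarith
    qed
    finally show "2 * a + K * b + 2 * b * of_bool (c < a) + drift G dG a b
       \<le> R * (lam * (\<integral>s. s\<^sup>2 \<partial>D) / (2 * \<epsilon>)) + lyapunov_bound K \<delta> t2 e"
      unfolding I_def ES2_def .
  qed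
qed

end

section \<open>Telescoping along the arrivals\<close>

text \<open>Independence of two variables of different types; the library's \<open>indep_var\<close> forces equal types.\<close>

definition (in prob_space) product_law where
  "product_law S X T Y \<longleftrightarrow> random_variable S X \<and> random_variable T Y \<and>
     distr M S X \<Otimes>\<^sub>M distr M T Y = distr M (S \<Otimes>\<^sub>M T) (\<lambda>\<omega>. (X \<omega>, Y \<omega>))"

lemma (in prob_space) indep_var_product_law:
  assumes ind: "indep_var S X T Y" and [measurable]: "f \<in> S \<rightarrow>\<^sub>M S'" "h \<in> T \<rightarrow>\<^sub>M T'"
  shows "product_law S' (\<lambda>\<omega>. f (X \<omega>)) T' (\<lambda>\<omega>. h (Y \<omega>))"
proof -
  have rv[measurable]: "random_variable S X" "random_variable T Y"
    and eq: "distr M S X \<Otimes>\<^sub>M distr M T Y = distr M (S \<Otimes>\<^sub>M T) (\<lambda>\<omega>. (X \<omega>, Y \<omega>))"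
    using ind by (auto simp: indep_var_distribution_eq)
  have rv2: "random_variable T' (\<lambda>\<omega>. h (Y \<omega>))" by measurable
  interpret H: prob_space "distr M T' (\<lambda>\<omega>. h (Y \<omega>))" by (rule prob_space_distr[OF rv2])
  have d: "distr (distr M S X) S' f = distr M S' (\<lambda>\<omega>. f (X \<omega>))"
    "distr (distr M T Y) T' h = distr M T' (\<lambda>\<omega>. h (Y \<omega>))"
    by (simp_all add: distr_distr comp_def)
  have "distr (distr M S X) S' f \<Otimes>\<^sub>M distr (distr M T Y) T' h
      = distr (distr M S X \<Otimes>\<^sub>M distr M T Y) (S' \<Otimes>\<^sub>M T') (\<lambda>(x, y). (f x, h y))"
    by (rule pair_measure_distr) (simp_all add: d H.sigma_finite_measure_axioms)
  then show ?thesis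
    unfolding product_law_def eq d by (simp add: distr_distr comp_def)
qed

text \<open>Conditioning on \<open>X\<close> with \<open>Y\<close> averaged out, phrased as Fubini
  on the product law so that no conditional expectation is needed.\<close>

lemma (in prob_space) product_law_expectation:
  fixes \<phi> :: "'b \<times> 'c \<Rightarrow> real"
  assumes ind: "product_law S X T Y" and m: "\<phi> \<in> borel_measurable (S \<Otimes>\<^sub>M T)"
    and int: "integrable M (\<lambda>\<omega>. \<phi> (X \<omega>, Y \<omega>))"
  shows "expectation (\<lambda>\<omega>. \<phi> (X \<omega>, Y \<omega>)) = expectation (\<lambda>\<omega>. \<integral>t. \<phi> (X \<omega>, t) \<partial>distr M T Y)"
    and "integrable M (\<lambda>\<omega>. \<integral>t. \<phi> (X \<omega>, t) \<partial>distr M T Y)"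
proof -
  have rv[measurable]: "random_variable S X" "random_variable T Y"
    and eq: "distr M S X \<Otimes>\<^sub>M distr M T Y = distr M (S \<Otimes>\<^sub>M T) (\<lambda>\<omega>. (X \<omega>, Y \<omega>))"
    using ind by (auto simp: product_law_def)
  interpret SX: prob_space "distr M S X" by (rule prob_space_distr) fact
  interpret TY: prob_space "distr M T Y" by (rule prob_space_distr) fact
  interpret P: pair_sigma_finite "distr M S X" "distr M T Y" ..
  have "integrable (distr M (S \<Otimes>\<^sub>M T) (\<lambda>\<omega>. (X \<omega>, Y \<omega>))) \<phi>"
    using int m by (subst integrable_distr_eq) auto
  then have i: "integrable (distr M S X \<Otimes>\<^sub>M distr M T Y) \<phi>" by (simp add: eq)
  have mi: "(\<lambda>x. \<integral>t. \<phi> (x, t) \<partial>distr M T Y) \<in> borel_measurable S"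
    using borel_measurable_integrable[OF P.integrable_fst'[OF i]] by simp
  show "integrable M (\<lambda>\<omega>. \<integral>t. \<phi> (X \<omega>, t) \<partial>distr M T Y)"
    using P.integrable_fst'[OF i] mi by (subst (asm) integrable_distr_eq) auto
  have "expectation (\<lambda>\<omega>. \<phi> (X \<omega>, Y \<omega>)) = integral\<^sup>L (distr M S X \<Otimes>\<^sub>M distr M T Y) \<phi>"
    unfolding eq using m by (subst integral_distr) auto
  also have "\<dots> = (\<integral>x. \<integral>t. \<phi> (x, t) \<partial>distr M T Y \<partial>distr M S X)"
    by (rule P.integral_fst'[OF i, symmetric])
  also have "\<dots> = expectation (\<lambda>\<omega>. \<integral>t. \<phi> (X \<omega>, t) \<partial>distr M T Y)"
    using mi by (subst integral_distr) auto
  finally show "expectation (\<lambda>\<omega>. \<phi> (X \<omega>, Y \<omega>)) = \<dots>" .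
qed

section \<open>The queue as a function of independent inputs\<close>

locale card_queue = card_drift + P: prob_space M
  for M :: "'a measure" +
  fixes X Sz :: "nat \<Rightarrow> 'a \<Rightarrow> real"
  assumes Xdist: "\<And>n. distributed M lborel (X n) (exponential_density lam)"
    and Sdist: "\<And>n. distr M borel (Sz n) = D"
    and Srv: "\<And>n. Sz n \<in> borel_measurable M"
    and indep: "P.indep_vars (\<lambda>_. borel) (\<lambda>i. case i of Inl n \<Rightarrow> X n | Inr n \<Rightarrow> Sz n) UNIV"
begin

abbreviation state :: "nat \<Rightarrow> 'a \<Rightarrow> real \<times> real" where
  "state n \<omega> \<equiv> card_state m_minus m_plus c (\<lambda>k. X k \<omega>) (\<lambda>k. Sz k \<omega>) n"

text \<open>One step of the recursion is cut just after the arrival, because size and gap are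
  averaged out separately: first \<open>joined\<close> with the size, then \<open>served\<close>
  with the gap.\<close>

definition joined :: "real \<times> real \<Rightarrow> real \<Rightarrow> real \<times> real" where
  "joined w s = (if s < cutoff (fst w) then (fst w + s, snd w) else (fst w, snd w + s))"

definition served :: "real \<times> real \<Rightarrow> real \<Rightarrow> real \<times> real" where
  "served w t = (max 0 (fst w - t / 2), max 0 (snd w - t / 2))"

lemma card_state_Suc:
  "card_state m_minus m_plus c x s (Suc n) = served (joined (card_state m_minus m_plus c x s n) (s n)) (x n)"
  by (simp add: served_def joined_def cutoff_iff Let_def split: prod.split)

lemma joined_measurable [measurable]:
  "(\<lambda>(w, s). joined w s) \<in> (borel \<Otimes>\<^sub>M borel) \<Otimes>\<^sub>M borel \<rightarrow>\<^sub>M borel \<Otimes>\<^sub>M borel"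
  unfolding joined_def cutoff_def split_beta' by measurable

lemma served_measurable [measurable]:
  "(\<lambda>(w, s). served w s) \<in> (borel \<Otimes>\<^sub>M borel) \<Otimes>\<^sub>M borel \<rightarrow>\<^sub>M borel \<Otimes>\<^sub>M borel"
  unfolding served_def split_beta' by measurable

text \<open>The state as a map on the product space of all inputs. Its dependence on the earlier
  inputs alone then becomes invariance under restriction to \<open>past n\<close>, the form in which
  grouped independence applies.\<close>

definition coord_state :: "nat \<Rightarrow> (nat + nat \<Rightarrow> real) \<Rightarrow> real \<times> real" where
  "coord_state n z = card_state m_minus m_plus c (\<lambda>k. z (Inl k)) (\<lambda>k. z (Inr k)) n"

definition past :: "nat \<Rightarrow> (nat + nat) set" where
  "past n = Inl ` {..<n} \<union> Inr ` {..<n}"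

lemma coord_state_restrict: "past n \<subseteq> A \<Longrightarrow> coord_state n (restrict z A) = coord_state n z"
proof (induction n)
  case (Suc n)
  then have "past n \<subseteq> A" "Inl n \<in> A" "Inr n \<in> A" by (auto simp: past_def)
  with Suc.IH show ?case by (simp add: coord_state_def card_state_Suc del: card_state.simps)
qed (simp add: coord_state_def)

lemma coord_state_measurable:
  "past n \<subseteq> A \<Longrightarrow> coord_state n \<in> PiM A (\<lambda>_. borel) \<rightarrow>\<^sub>M borel \<Otimes>\<^sub>M borel"
proof (induction n)
  case 0
  show ?case by (simp add: coord_state_def)
next
  case (Suc n)
  then have A: "past n \<subseteq> A" "Inl n \<in> A" "Inr n \<in> A" by (auto simp: past_def)
  note [measurable] = Suc.IH[OF A(1)] measurable_component_singleton[OF A(2), of "\<lambda>_. borel"]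
    measurable_component_singleton[OF A(3), of "\<lambda>_. borel"]
  have "(\<lambda>z. joined (coord_state n z) (z (Inr n))) \<in> PiM A (\<lambda>_. borel) \<rightarrow>\<^sub>M borel \<Otimes>\<^sub>M borel"
    using measurable_compose[OF _ joined_measurable, of "\<lambda>z. (coord_state n z, z (Inr n))"] by simp
  then have "(\<lambda>z. served (joined (coord_state n z) (z (Inr n))) (z (Inl n))) \<in> PiM A (\<lambda>_. borel) \<rightarrow>\<^sub>M borel \<Otimes>\<^sub>M borel"
    using measurable_compose[OF _ served_measurable, of "\<lambda>z. (joined (coord_state n z) (z (Inr n)), z (Inl n))"]
    by simp
  then show ?case by (simp add: coord_state_def[abs_def] card_state_Suc del: card_state.simps)
qed

abbreviation noise :: "'a \<Rightarrow> nat + nat \<Rightarrow> real" where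
  "noise \<omega> i \<equiv> (case i of Inl n \<Rightarrow> X n | Inr n \<Rightarrow> Sz n) \<omega>"

lemma state_eq: "past n \<subseteq> A \<Longrightarrow> state n \<omega> = coord_state n (restrict (noise \<omega>) A)"
  by (subst coord_state_restrict) (simp_all add: coord_state_def)

lemma indep_state_size: "P.product_law (borel \<Otimes>\<^sub>M borel) (state n) borel (Sz n)"
proof -
  have "P.indep_var (PiM (past n) (\<lambda>_. borel)) (\<lambda>\<omega>. restrict (noise \<omega>) (past n))
      (PiM {Inr n} (\<lambda>_. borel)) (\<lambda>\<omega>. restrict (noise \<omega>) {Inr n})"
    by (rule P.indep_var_restrict[OF indep]) (auto simp: past_def)
  from P.indep_var_product_law[OF this, of "coord_state n" "borel \<Otimes>\<^sub>M borel" "\<lambda>z. z (Inr n)" borel]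
  show ?thesis
    by (simp add: coord_state_measurable measurable_component_singleton state_eq[of n "past n", symmetric])
qed

lemma indep_joined_gap: "P.product_law (borel \<Otimes>\<^sub>M borel) (\<lambda>\<omega>. joined (state n \<omega>) (Sz n \<omega>)) borel (X n)"
proof -
  \<comment> \<open>The post-arrival state also uses the size of job \<open>n\<close>, but not the
    gap that follows it.\<close>
  let ?A = "insert (Inr n) (past n)"
  have ind: "P.indep_var (PiM ?A (\<lambda>_. borel)) (\<lambda>\<omega>. restrict (noise \<omega>) ?A)
      (PiM {Inl n} (\<lambda>_. borel)) (\<lambda>\<omega>. restrict (noise \<omega>) {Inl n})"
    by (rule P.indep_var_restrict[OF indep]) (auto simp: past_def)
  have "(\<lambda>z. (coord_state n z, z (Inr n))) \<in> PiM ?A (\<lambda>_. borel) \<rightarrow>\<^sub>M (borel \<Otimes>\<^sub>M borel) \<Otimes>\<^sub>M borel"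
    by (intro measurable_Pair coord_state_measurable measurable_component_singleton) auto
  from measurable_compose[OF this joined_measurable]
  have "(\<lambda>z. joined (coord_state n z) (z (Inr n))) \<in> PiM ?A (\<lambda>_. borel) \<rightarrow>\<^sub>M borel \<Otimes>\<^sub>M borel"
    by simp
  from P.indep_var_product_law[OF ind this, of "\<lambda>z. z (Inl n)" borel]
  show ?thesis
    by (simp add: measurable_component_singleton state_eq[of n ?A, symmetric] subset_insertI)
qed

lemma state_measurable [measurable]: "state n \<in> M \<rightarrow>\<^sub>M borel \<Otimes>\<^sub>M borel"
  using indep_state_size by (simp add: P.product_law_def)

lemma size_measurable [measurable]: "Sz n \<in> borel_measurable M"
  by (rule Srv)

lemma gap_measurable [measurable]: "X n \<in> borel_measurable M"
  using indep_joined_gap by (simp add: P.product_law_def)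

lemma gap_distr: "distr M borel (X n) = density lborel (exponential_density lam)"
proof -
  have "distr M borel (X n) = distr M lborel (X n)" by (rule distr_cong) auto
  then show ?thesis using distributed_distr_eq_density[OF Xdist] by simp
qed

lemma gap_nonneg: "AE \<omega> in M. 0 \<le> X n \<omega>"
proof -
  have "AE x in distr M borel (X n). 0 \<le> x"
    unfolding gap_distr by (subst AE_density) (auto simp: exponential_density_def)
  then show ?thesis by (rule AE_distrD[rotated]) simp
qed

lemma sz_pos: "AE \<omega> in M. 0 < Sz n \<omega>"
proof -
  have "AE x in distr M borel (Sz n). 0 < x" unfolding Sdist by (rule size_pos)
  then show ?thesis by (rule AE_distrD[rotated]) simp
qed

lemma sz_sq: "integrable M (\<lambda>\<omega>. (Sz n \<omega>)\<^sup>2)"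
  using size_sq unfolding Sdist[of n, symmetric] by (subst (asm) integrable_distr_eq) auto

lemma sz_int: "integrable M (Sz n)"
  using size_integrable unfolding Sdist[of n, symmetric] by (subst (asm) integrable_distr_eq) auto

section \<open>Moments of the workload along the arrivals\<close>

lemma state_nonneg: "0 \<le> fst (state n \<omega>)" "0 \<le> snd (state n \<omega>)"
  by (induction n) (simp_all add: card_state_Suc served_def del: card_state.simps(2))

text \<open>Each arrival adds at most \<open>m_plus\<close> to the short server. This almost sure
  bound at each fixed \<open>n\<close> is why growth that is only local in \<open>a\<close> suffices
  for integrability.\<close>

lemma state_fst_le: "AE \<omega> in M. fst (state n \<omega>) \<le> real n * m_plus"
proof (induction n)
  case (Suc n)
  from Suc gap_nonneg[of n] show ?case
  proof eventually_elim
    case (elim \<omega>)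
    have "fst (joined (state n \<omega>) (Sz n \<omega>)) \<le> real n * m_plus + m_plus"
      using elim cutoff_le[of "fst (state n \<omega>)"] m_plus_pos by (auto simp: joined_def)
    moreover have "0 \<le> real n * m_plus + m_plus" using m_plus_pos by simp
    ultimately show ?case
      using elim by (simp add: card_state_Suc served_def algebra_simps del: card_state.simps)
  qed
qed simp

lemma snd_joined_sq:
  assumes "0 < s" "0 \<le> snd w"
  shows "(snd (joined w s))\<^sup>2 \<le> 2 * (snd w)\<^sup>2 + 2 * s\<^sup>2"
  using sum_squares_bound[of "snd w" s] by (auto simp: joined_def power2_sum)

lemma state_snd_sq: "integrable M (\<lambda>\<omega>. (snd (state n \<omega>))\<^sup>2)"
proof (induction n)
  case (Suc n)
  have "integrable M (\<lambda>\<omega>. 2 * (snd (state n \<omega>))\<^sup>2 + 2 * (Sz n \<omega>)\<^sup>2)"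
    using Suc sz_sq by simp
  then show ?case
  proof (rule Bochner_Integration.integrable_bound)
    show "AE \<omega> in M. norm ((snd (state (Suc n) \<omega>))\<^sup>2) \<le> norm (2 * (snd (state n \<omega>))\<^sup>2 + 2 * (Sz n \<omega>)\<^sup>2)"
      using gap_nonneg[of n] sz_pos[of n]
    proof eventually_elim
      case (elim \<omega>)
      have "0 \<le> snd (joined (state n \<omega>) (Sz n \<omega>))"
        using state_nonneg[where n = n and \<omega> = \<omega>] elim by (auto simp: joined_def)
      then have "(snd (state (Suc n) \<omega>))\<^sup>2 \<le> (snd (joined (state n \<omega>) (Sz n \<omega>)))\<^sup>2"
        using elim by (intro power_mono) (auto simp: card_state_Suc served_def simp del: card_state.simps)
      also have "\<dots> \<le> 2 * (snd (state n \<omega>))\<^sup>2 + 2 * (Sz n \<omega>)\<^sup>2"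
        using elim state_nonneg by (intro snd_joined_sq) auto
      finally show ?case by simp
    qed
  qed measurable
qed simp

lemma integrable_growth:
  fixes g :: "real \<Rightarrow> real \<Rightarrow> real"
  assumes g: "(\<lambda>w. g (fst w) (snd w)) \<in> borel_measurable (borel \<Otimes>\<^sub>M borel)"
    and bd: "\<And>a b. 0 \<le> a \<Longrightarrow> a \<le> A \<Longrightarrow> 0 \<le> b \<Longrightarrow> \<bar>g a b\<bar> \<le> C * (1 + b\<^sup>2)"
    and Y: "Y \<in> M \<rightarrow>\<^sub>M borel \<Otimes>\<^sub>M borel"
    and AE: "AE \<omega> in M. 0 \<le> fst (Y \<omega>) \<and> fst (Y \<omega>) \<le> A \<and> 0 \<le> snd (Y \<omega>)"
    and sq: "integrable M (\<lambda>\<omega>. (snd (Y \<omega>))\<^sup>2)"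
  shows "integrable M (\<lambda>\<omega>. g (fst (Y \<omega>)) (snd (Y \<omega>)))"
proof (rule Bochner_Integration.integrable_bound)
  show "integrable M (\<lambda>\<omega>. C * (1 + (snd (Y \<omega>))\<^sup>2))" using sq by simp
  show "(\<lambda>\<omega>. g (fst (Y \<omega>)) (snd (Y \<omega>))) \<in> borel_measurable M"
    using measurable_compose[OF Y g] .
  show "AE \<omega> in M. norm (g (fst (Y \<omega>)) (snd (Y \<omega>))) \<le> norm (C * (1 + (snd (Y \<omega>))\<^sup>2))"
    using AE
  proof eventually_elim
    case (elim \<omega>)
    then have "\<bar>g (fst (Y \<omega>)) (snd (Y \<omega>))\<bar> \<le> C * (1 + (snd (Y \<omega>))\<^sup>2)" by (intro bd) auto
    then show ?case by (simp add: abs_le_iff)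
  qed
qed

lemma state_integrable:
  assumes "service_pair lam g dg"
  shows "integrable M (\<lambda>\<omega>. g (fst (state n \<omega>)) (snd (state n \<omega>)))"
    "integrable M (\<lambda>\<omega>. dg (fst (state n \<omega>)) (snd (state n \<omega>)))"
proof -
  obtain C where "0 \<le> C" and C: "\<And>a b. 0 \<le> a \<Longrightarrow> a \<le> real n * m_plus \<Longrightarrow> 0 \<le> b \<Longrightarrow>
      \<bar>g a b\<bar> \<le> C * (1 + b\<^sup>2) \<and> \<bar>dg a b\<bar> \<le> C * (1 + b\<^sup>2)"
    by (rule service_pair_bound[OF assms, of "real n * m_plus"]) (rule that)
  have AE: "AE \<omega> in M. 0 \<le> fst (state n \<omega>) \<and> fst (state n \<omega>) \<le> real n * m_plus \<and> 0 \<le> snd (state n \<omega>)"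
    using state_fst_le by eventually_elim (auto simp: state_nonneg)
  show "integrable M (\<lambda>\<omega>. g (fst (state n \<omega>)) (snd (state n \<omega>)))"
    using C by (intro integrable_growth[OF service_pair_measurable(1)[OF assms] _ state_measurable AE state_snd_sq]) blast
  show "integrable M (\<lambda>\<omega>. dg (fst (state n \<omega>)) (snd (state n \<omega>)))"
    using C by (intro integrable_growth[OF service_pair_measurable(2)[OF assms] _ state_measurable AE state_snd_sq]) blast
qed

abbreviation "post_state n \<omega> \<equiv> joined (state n \<omega>) (Sz n \<omega>)"

lemma post_state_measurable [measurable]: "post_state n \<in> M \<rightarrow>\<^sub>M borel \<Otimes>\<^sub>M borel"
  using indep_joined_gap by (simp add: P.product_law_def)

lemma post_state_nonneg: "AE \<omega> in M. 0 \<le> fst (post_state n \<omega>) \<and> 0 \<le> snd (post_state n \<omega>)"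
  using sz_pos[of n]
proof eventually_elim
  case (elim \<omega>)
  then show ?case using state_nonneg[where n = n and \<omega> = \<omega>] by (auto simp: joined_def)
qed

lemma post_state_integrable:
  assumes "service_pair lam g dg"
  shows "integrable M (\<lambda>\<omega>. g (fst (post_state n \<omega>)) (snd (post_state n \<omega>)))"
proof -
  obtain C where "0 \<le> C" and C: "\<And>a b. 0 \<le> a \<Longrightarrow> a \<le> real n * m_plus + m_plus \<Longrightarrow> 0 \<le> b \<Longrightarrow>
      \<bar>g a b\<bar> \<le> C * (1 + b\<^sup>2) \<and> \<bar>dg a b\<bar> \<le> C * (1 + b\<^sup>2)"
    by (rule service_pair_bound[OF assms, of "real n * m_plus + m_plus"]) (rule that)
  have AE: "AE \<omega> in M. 0 \<le> fst (post_state n \<omega>) \<and> fst (post_state n \<omega>) \<le> real n * m_plus + m_plus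
      \<and> 0 \<le> snd (post_state n \<omega>)"
    using state_fst_le[of n] post_state_nonneg[of n]
  proof eventually_elim
    case (elim \<omega>)
    then show ?case using cutoff_le[of "fst (state n \<omega>)"] m_plus_pos by (auto simp: joined_def)
  qed
  have "integrable M (\<lambda>\<omega>. 2 * (snd (state n \<omega>))\<^sup>2 + 2 * (Sz n \<omega>)\<^sup>2)"
    using state_snd_sq sz_sq by simp
  then have sq: "integrable M (\<lambda>\<omega>. (snd (post_state n \<omega>))\<^sup>2)"
  proof (rule Bochner_Integration.integrable_bound)
    show "AE \<omega> in M. norm ((snd (post_state n \<omega>))\<^sup>2) \<le> norm (2 * (snd (state n \<omega>))\<^sup>2 + 2 * (Sz n \<omega>)\<^sup>2)"
      using sz_pos[of n] by eventually_elim (use snd_joined_sq state_nonneg in auto)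
  qed measurable
  show ?thesis
    using C by (intro integrable_growth[OF service_pair_measurable(1)[OF assms] _ post_state_measurable AE sq]) blast
qed

section \<open>One-step averages and the telescoped drift\<close>

lemma expectation_post:
  assumes sp: "service_pair lam g dg"
  shows "P.expectation (\<lambda>\<omega>. g (fst (post_state n \<omega>)) (snd (post_state n \<omega>)))
       = P.expectation (\<lambda>\<omega>. \<integral>s. post g (fst (state n \<omega>)) (snd (state n \<omega>)) s \<partial>D)"
    and "integrable M (\<lambda>\<omega>. \<integral>s. post g (fst (state n \<omega>)) (snd (state n \<omega>)) s \<partial>D)"
proof -
  have eq: "g (fst (joined w s)) (snd (joined w s)) = post g (fst w) (snd w) s" for w s
    by (simp add: joined_def post_def)
  have int: "integrable M (\<lambda>\<omega>. (\<lambda>(w, s). post g (fst w) (snd w) s) (state n \<omega>, Sz n \<omega>))"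
    using post_state_integrable[OF sp, of n] by (simp add: eq)
  from P.product_law_expectation[OF indep_state_size post_measurable[OF sp] int]
  show "P.expectation (\<lambda>\<omega>. g (fst (post_state n \<omega>)) (snd (post_state n \<omega>)))
       = P.expectation (\<lambda>\<omega>. \<integral>s. post g (fst (state n \<omega>)) (snd (state n \<omega>)) s \<partial>D)"
    "integrable M (\<lambda>\<omega>. \<integral>s. post g (fst (state n \<omega>)) (snd (state n \<omega>)) s \<partial>D)"
    by (simp_all add: eq Sdist)
qed

lemma served_rate_measurable:
  assumes sp: "service_pair lam g dg"
  shows "(\<lambda>(w, t). g (fst (served w t)) (snd (served w t)) + dg (fst (served w t)) (snd (served w t)) / lam)
    \<in> borel_measurable ((borel \<Otimes>\<^sub>M borel) \<Otimes>\<^sub>M borel)"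
proof -
  note [measurable] = service_pair_measurable[OF sp]
  have "(\<lambda>w. g (fst w) (snd w) + dg (fst w) (snd w) / lam) \<in> borel_measurable (borel \<Otimes>\<^sub>M borel)"
    by measurable
  from measurable_compose[OF served_measurable this] show ?thesis by (simp add: split_beta')
qed

lemma expectation_service:
  assumes sp: "service_pair lam g dg"
  shows "P.expectation (\<lambda>\<omega>. g (fst (state (Suc n) \<omega>)) (snd (state (Suc n) \<omega>))
           + dg (fst (state (Suc n) \<omega>)) (snd (state (Suc n) \<omega>)) / lam)
       = P.expectation (\<lambda>\<omega>. g (fst (post_state n \<omega>)) (snd (post_state n \<omega>)))"
proof -
  let ?f = "\<lambda>w. g (fst w) (snd w) + dg (fst w) (snd w) / lam"
  note m = served_rate_measurable[OF sp]
  have int: "integrable M (\<lambda>\<omega>. (\<lambda>(w, t). ?f (served w t)) (post_state n \<omega>, X n \<omega>))"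
    using state_integrable[OF sp, of "Suc n"] by (simp add: card_state_Suc del: card_state.simps)
  have "P.expectation (\<lambda>\<omega>. ?f (state (Suc n) \<omega>))
     = P.expectation (\<lambda>\<omega>. \<integral>t. ?f (served (post_state n \<omega>) t) \<partial>density lborel (exponential_density lam))"
    using P.product_law_expectation(1)[OF indep_joined_gap m int]
    by (simp add: card_state_Suc gap_distr del: card_state.simps)
  also have "\<dots> = P.expectation (\<lambda>\<omega>. g (fst (post_state n \<omega>)) (snd (post_state n \<omega>)))"
  proof (rule Bochner_Integration.integral_cong_AE)
    have eq: "AE \<omega> in M. (\<integral>t. ?f (served (post_state n \<omega>) t) \<partial>density lborel (exponential_density lam))
       = g (fst (post_state n \<omega>)) (snd (post_state n \<omega>))"
      using post_state_nonneg[of n]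
    proof eventually_elim
      case (elim \<omega>)
      then show ?case using service_pair_integral[OF sp, of "fst (post_state n \<omega>)" "snd (post_state n \<omega>)"]
        by (simp add: served_def)
    qed
    then show "AE \<omega> in M. (\<integral>t. ?f (served (post_state n \<omega>) t) \<partial>density lborel (exponential_density lam))
       = g (fst (post_state n \<omega>)) (snd (post_state n \<omega>))" .
    show "(\<lambda>\<omega>. \<integral>t. ?f (served (post_state n \<omega>) t) \<partial>density lborel (exponential_density lam)) \<in> borel_measurable M"
      using borel_measurable_integrable[OF P.product_law_expectation(2)[OF indep_joined_gap m int]]
      by (simp add: gap_distr)
    show "(\<lambda>\<omega>. g (fst (post_state n \<omega>)) (snd (post_state n \<omega>))) \<in> borel_measurable M"
      using borel_measurable_integrable[OF post_state_integrable[OF sp]] .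
  qed
  finally show ?thesis .
qed

lemma drift_integrable:
  assumes "service_pair lam g dg"
  shows "integrable M (\<lambda>\<omega>. drift g dg (fst (state n \<omega>)) (snd (state n \<omega>)))"
  unfolding drift_def using state_integrable[OF assms] expectation_post(2)[OF assms] by simp

text \<open>The telescoping quantity is the mean of \<open>g + dg / lam\<close>, not of
  \<open>g\<close>: the next value of the former equals the current post-arrival mean of
  \<open>g\<close>, which is the jump part of the drift.\<close>

lemma sum_drift:
  assumes sp: "service_pair lam g dg"
  shows "(\<Sum>n<N. P.expectation (\<lambda>\<omega>. drift g dg (fst (state n \<omega>)) (snd (state n \<omega>))))
    = lam * P.expectation (\<lambda>\<omega>. g (fst (state N \<omega>)) (snd (state N \<omega>)) + dg (fst (state N \<omega>)) (snd (state N \<omega>)) / lam)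
      - lam * g 0 0"
proof (induction N)
  case 0
  interpret E: prob_space "density lborel (exponential_density lam)"
    using prob_space_exponential_density[OF lam_pos] .
  let ?f = "\<lambda>t. g (max 0 (0 - t / 2)) (max 0 (0 - t / 2)) + dg (max 0 (0 - t / 2)) (max 0 (0 - t / 2)) / lam"
  have "(\<integral>t. ?f t \<partial>density lborel (exponential_density lam))
      = (\<integral>t. g 0 0 + dg 0 0 / lam \<partial>density lborel (exponential_density lam))"
  proof (rule integral_cong_AE)
    have "(\<lambda>t. ((0, 0), t)) \<in> borel \<rightarrow>\<^sub>M (borel \<Otimes>\<^sub>M borel) \<Otimes>\<^sub>M (borel :: real measure)" by simp
    from measurable_compose[OF this served_rate_measurable[OF sp]]
    show "?f \<in> borel_measurable (density lborel (exponential_density lam))" by (simp add: served_def)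
    \<comment> \<open>An empty system stays empty for \<open>t \<ge> 0\<close>, so the service
      identity at the origin forces \<open>dg 0 0 = 0\<close>, and the sum starts from
      \<open>g 0 0\<close>.\<close>
    have "?f t = g 0 0 + dg 0 0 / lam" if "0 \<le> t" for t using that by (simp add: max_absorb1)
    then show "AE t in density lborel (exponential_density lam). ?f t = g 0 0 + dg 0 0 / lam"
      by (subst AE_density) (auto simp: exponential_density_def)
  qed simp
  then have "g 0 0 + dg 0 0 / lam = g 0 0"
    using service_pair_integral[OF sp, of 0 0] E.prob_space by simp
  then show ?case by (simp add: P.prob_space)
next
  case (Suc N)
  have "P.expectation (\<lambda>\<omega>. drift g dg (fst (state N \<omega>)) (snd (state N \<omega>)))
     = lam * (P.expectation (\<lambda>\<omega>. g (fst (post_state N \<omega>)) (snd (post_state N \<omega>)))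
        - P.expectation (\<lambda>\<omega>. g (fst (state N \<omega>)) (snd (state N \<omega>))))
       - P.expectation (\<lambda>\<omega>. dg (fst (state N \<omega>)) (snd (state N \<omega>)))"
    unfolding drift_def expectation_post(1)[OF sp]
    using state_integrable[OF sp, of N] expectation_post(2)[OF sp, of N] by simp
  moreover have "lam * P.expectation (\<lambda>\<omega>. g (fst (state N \<omega>)) (snd (state N \<omega>)) + dg (fst (state N \<omega>)) (snd (state N \<omega>)) / lam)
    = lam * P.expectation (\<lambda>\<omega>. g (fst (state N \<omega>)) (snd (state N \<omega>))) + P.expectation (\<lambda>\<omega>. dg (fst (state N \<omega>)) (snd (state N \<omega>)))"
    using state_integrable[OF sp, of N] lam_pos by (simp add: distrib_left)
  ultimately show ?case
    using Suc.IH unfolding sum.lessThan_Suc expectation_service[OF sp] by (simp add: right_diff_distrib)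
qed

text \<open>No lower bound on \<open>dg\<close> is assumed. For \<open>N > 0\<close> the end term is
  therefore rewritten as the mean of \<open>g\<close> after the previous arrival, where
  \<open>- C\<close> applies.\<close>

lemma sum_drift_ge:
  assumes sp: "service_pair lam g dg" and lb: "\<And>a b. 0 \<le> a \<Longrightarrow> 0 \<le> b \<Longrightarrow> - C \<le> g a b"
  shows "- (lam * (C + g 0 0)) \<le> (\<Sum>n<N. P.expectation (\<lambda>\<omega>. drift g dg (fst (state n \<omega>)) (snd (state n \<omega>))))"
proof (cases N)
  case 0
  have "0 \<le> C + g 0 0" using lb[of 0 0] by simp
  then show ?thesis using 0 lam_pos by simp
next
  case (Suc n)
  have "P.expectation (\<lambda>\<omega>. - C) \<le> P.expectation (\<lambda>\<omega>. g (fst (post_state n \<omega>)) (snd (post_state n \<omega>)))"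
  proof (rule integral_mono_AE)
    show "AE \<omega> in M. - C \<le> g (fst (post_state n \<omega>)) (snd (post_state n \<omega>))"
      using post_state_nonneg[of n] by eventually_elim (use lb in blast)
  qed (use post_state_integrable[OF sp] in auto)
  then have "lam * (- C) \<le> lam * P.expectation (\<lambda>\<omega>. g (fst (post_state n \<omega>)) (snd (post_state n \<omega>)))"
    using lam_pos by (intro mult_left_mono) (auto simp: P.prob_space)
  then show ?thesis unfolding Suc sum_drift[OF sp] expectation_service[OF sp] by (simp add: algebra_simps)
qed

section \<open>From the drift bound to the mean response time\<close>

definition resp :: "real \<times> real \<Rightarrow> real \<Rightarrow> real" where
  "resp w s = (if s < cutoff (fst w) then 2 * (fst w + s) else 2 * (snd w + s))"

lemma card_resp_eq: "card_resp m_minus m_plus c (\<lambda>k. X k \<omega>) (\<lambda>k. Sz k \<omega>) n = resp (state n \<omega>) (Sz n \<omega>)"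
  by (simp add: card_resp_def resp_def cutoff_iff Let_def split: prod.split)

lemma resp_measurable: "(\<lambda>(w, s). resp w s) \<in> borel_measurable ((borel \<Otimes>\<^sub>M borel) \<Otimes>\<^sub>M borel)"
  unfolding resp_def cutoff_def split_beta' by measurable

text \<open>Up to \<open>c\<close> a job meets the long work only if its size is at least
  \<open>m_plus\<close>, which \<open>K\<close> covers. Above \<open>c\<close> the probability of
  going long is bounded by 1, whence the extra \<open>2 * b * 1(c < a)\<close>.\<close>

lemma resp_le:
  assumes K: "2 * prob {m_plus..} \<le> K" and w: "0 \<le> fst w" "0 \<le> snd w"
  shows "(\<integral>s. resp w s \<partial>D) \<le> 2 * (\<integral>s. s \<partial>D) + (2 * fst w + K * snd w + 2 * snd w * of_bool (c < fst w))"
proof -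
  have ind: "integrable D (\<lambda>s. indicator {cutoff (fst w)..} s :: real)"
    by (rule integrable_const_bound[where B = 1]) (auto simp: indicator_def)
  have "(\<integral>s. resp w s \<partial>D) \<le> (\<integral>s. 2 * s + 2 * fst w + 2 * snd w * indicator {cutoff (fst w)..} s \<partial>D)"
  proof (rule integral_mono)
    have "integrable D (\<lambda>s. 2 * s + (2 * fst w + (2 * snd w - 2 * fst w) * indicator {cutoff (fst w)..} s))"
      using size_integrable ind by simp
    then show "integrable D (resp w)"
      by (rule Bochner_Integration.integrable_cong[THEN iffD1, rotated -1]) (auto simp: resp_def indicator_def)
  qed (use size_integrable ind w in \<open>auto simp: resp_def\<close>)
  also have "\<dots> = 2 * (\<integral>s. s \<partial>D) + 2 * fst w + 2 * snd w * prob {cutoff (fst w)..}"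
    using size_integrable ind by (simp add: prob_space)
  also have "2 * snd w * prob {cutoff (fst w)..} \<le> K * snd w + 2 * snd w * of_bool (c < fst w)"
  proof (cases "c < fst w")
    case True
    have "0 \<le> K" using K measure_nonneg[of D "{m_plus..}"] by linarith
    then have "0 \<le> K * snd w" using w by simp
    moreover have "2 * snd w * prob {cutoff (fst w)..} \<le> 2 * snd w * 1" using w by (intro mult_left_mono) auto
    ultimately show ?thesis using True by simp
  next
    case False
    have "snd w * (2 * prob {m_plus..}) \<le> snd w * K" using K w by (intro mult_left_mono) auto
    then show ?thesis using False by (simp add: cutoff_def mult_ac)
  qed
  finally show ?thesis by simp
qed

lemma resp_integrable: "integrable M (\<lambda>\<omega>. resp (state n \<omega>) (Sz n \<omega>))"
proof (rule Bochner_Integration.integrable_bound)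
  have "integrable M (\<lambda>\<omega>. snd (state n \<omega>))"
    using state_snd_sq by (rule P.square_integrable_imp_integrable[rotated]) measurable
  then show "integrable M (\<lambda>\<omega>. 2 * (real n * m_plus) + 2 * snd (state n \<omega>) + 2 * Sz n \<omega>)"
    using sz_int by simp
  show "(\<lambda>\<omega>. resp (state n \<omega>) (Sz n \<omega>)) \<in> borel_measurable M"
    using measurable_compose[OF _ resp_measurable, of "\<lambda>\<omega>. (state n \<omega>, Sz n \<omega>)" M] by simp
  show "AE \<omega> in M. norm (resp (state n \<omega>) (Sz n \<omega>)) \<le> norm (2 * (real n * m_plus) + 2 * snd (state n \<omega>) + 2 * Sz n \<omega>)"
    using sz_pos[of n] state_fst_le[of n]
  proof eventually_elim
    case (elim \<omega>)
    have "0 \<le> resp (state n \<omega>) (Sz n \<omega>)" "resp (state n \<omega>) (Sz n \<omega>) \<le> 2 * (real n * m_plus) + 2 * snd (state n \<omega>) + 2 * Sz n \<omega>"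
      using elim state_nonneg[where n = n and \<omega> = \<omega>] m_plus_pos by (auto simp: resp_def)
    then show ?case by simp
  qed
qed

lemma sum_response_le:
  assumes sp: "service_pair lam g dg" and lb: "\<And>a b. 0 \<le> a \<Longrightarrow> 0 \<le> b \<Longrightarrow> - C \<le> g a b"
    and dr: "\<And>a b. 0 \<le> a \<Longrightarrow> 0 \<le> b \<Longrightarrow> 2 * a + K * b + 2 * b * of_bool (c < a) + drift g dg a b \<le> B"
    and K: "2 * prob {m_plus..} \<le> K"
  shows "(\<Sum>n<N. \<integral>\<^sup>+ \<omega>. ennreal (card_resp m_minus m_plus c (\<lambda>k. X k \<omega>) (\<lambda>k. Sz k \<omega>) n) \<partial>M)
    \<le> ennreal (real N * (B + 2 * (\<integral>s. s \<partial>D)) + lam * (C + g 0 0))"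
proof -
  let ?ES = "\<integral>s. s \<partial>D" and ?dr = "\<lambda>n. P.expectation (\<lambda>\<omega>. drift g dg (fst (state n \<omega>)) (snd (state n \<omega>)))"
  have nn: "AE \<omega> in M. 0 \<le> resp (state n \<omega>) (Sz n \<omega>)" for n
    using sz_pos[of n] by eventually_elim (auto simp: resp_def state_nonneg)
  have int: "integrable M (\<lambda>\<omega>. (\<lambda>(w, s). resp w s) (state n \<omega>, Sz n \<omega>))" for n
    using resp_integrable by simp
  have le: "P.expectation (\<lambda>\<omega>. resp (state n \<omega>) (Sz n \<omega>)) \<le> B + 2 * ?ES - ?dr n" for n
  proof -
    note e = P.product_law_expectation[OF indep_state_size resp_measurable int[of n]]
    have "P.expectation (\<lambda>\<omega>. resp (state n \<omega>) (Sz n \<omega>)) = P.expectation (\<lambda>\<omega>. \<integral>s. resp (state n \<omega>) s \<partial>D)"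
      using e(1) by (simp add: Sdist)
    also have "\<dots> \<le> P.expectation (\<lambda>\<omega>. B + 2 * ?ES - drift g dg (fst (state n \<omega>)) (snd (state n \<omega>)))"
    proof (rule integral_mono)
      show "integrable M (\<lambda>\<omega>. \<integral>s. resp (state n \<omega>) s \<partial>D)" using e(2) by (simp add: Sdist)
      show "integrable M (\<lambda>\<omega>. B + 2 * ?ES - drift g dg (fst (state n \<omega>)) (snd (state n \<omega>)))"
        using drift_integrable[OF sp] by simp
      fix \<omega>
      show "(\<integral>s. resp (state n \<omega>) s \<partial>D) \<le> B + 2 * ?ES - drift g dg (fst (state n \<omega>)) (snd (state n \<omega>))"
        using resp_le[OF K state_nonneg[where n = n and \<omega> = \<omega>]]
          dr[OF state_nonneg[where n = n and \<omega> = \<omega>]] by linarith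
    qed
    also have "\<dots> = B + 2 * ?ES - ?dr n" using drift_integrable[OF sp] by (simp add: P.prob_space)
    finally show ?thesis .
  qed
  have "(\<Sum>n<N. \<integral>\<^sup>+ \<omega>. ennreal (card_resp m_minus m_plus c (\<lambda>k. X k \<omega>) (\<lambda>k. Sz k \<omega>) n) \<partial>M)
     = (\<Sum>n<N. ennreal (P.expectation (\<lambda>\<omega>. resp (state n \<omega>) (Sz n \<omega>))))"
    unfolding card_resp_eq by (intro sum.cong refl nn_integral_eq_integral resp_integrable nn)
  also have "\<dots> = ennreal (\<Sum>n<N. P.expectation (\<lambda>\<omega>. resp (state n \<omega>) (Sz n \<omega>)))"
    using nn by (intro sum_ennreal integral_nonneg_AE)
  also have "\<dots> \<le> ennreal (real N * (B + 2 * ?ES) + lam * (C + g 0 0))"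
  proof (rule ennreal_leI)
    have "(\<Sum>n<N. P.expectation (\<lambda>\<omega>. resp (state n \<omega>) (Sz n \<omega>))) \<le> (\<Sum>n<N. B + 2 * ?ES - ?dr n)"
      by (intro sum_mono le)
    also have "\<dots> = real N * (B + 2 * ?ES) - (\<Sum>n<N. ?dr n)" by (simp add: sum_subtractf)
    also have "\<dots> \<le> real N * (B + 2 * ?ES) + lam * (C + g 0 0)" using sum_drift_ge[OF sp lb, where N = N] by linarith
    finally show "(\<Sum>n<N. P.expectation (\<lambda>\<omega>. resp (state n \<omega>) (Sz n \<omega>))) \<le> real N * (B + 2 * ?ES) + lam * (C + g 0 0)" .
  qed
  finally show ?thesis .
qed

lemma mean_resp_le:
  assumes sp: "service_pair lam g dg" and lb: "\<And>a b. 0 \<le> a \<Longrightarrow> 0 \<le> b \<Longrightarrow> - C \<le> g a b"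
    and dr: "\<And>a b. 0 \<le> a \<Longrightarrow> 0 \<le> b \<Longrightarrow> 2 * a + K * b + 2 * b * of_bool (c < a) + drift g dg a b \<le> B"
    and K: "2 * prob {m_plus..} \<le> K"
  shows "mean_resp_CARD M X Sz m_minus m_plus c \<le> ennreal (B + 2 * (\<integral>s. s \<partial>D))"
proof -
  let ?b = "B + 2 * (\<integral>s. s \<partial>D)" and ?d = "lam * (C + g 0 0)"
  have "mean_resp_CARD M X Sz m_minus m_plus c \<le> limsup (\<lambda>N. ennreal (?b + ?d / real N))"
    unfolding mean_resp_CARD_def
  proof (rule Limsup_mono)
    show "\<forall>\<^sub>F N in sequentially. (\<Sum>n<N. \<integral>\<^sup>+ \<omega>. ennreal (card_resp m_minus m_plus c (\<lambda>k. X k \<omega>) (\<lambda>k. Sz k \<omega>) n) \<partial>M)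
        / of_nat N \<le> ennreal (?b + ?d / real N)"
      using eventually_gt_at_top[of 0]
    proof eventually_elim
      case (elim N)
      have "(\<Sum>n<N. \<integral>\<^sup>+ \<omega>. ennreal (card_resp m_minus m_plus c (\<lambda>k. X k \<omega>) (\<lambda>k. Sz k \<omega>) n) \<partial>M) / of_nat N
          \<le> ennreal (real N * ?b + ?d) / of_nat N"
        by (intro divide_right_mono_ennreal sum_response_le[OF sp lb dr K])
      also have "\<dots> = ennreal ((real N * ?b + ?d) / real N)"
        \<comment> \<open>\<open>ennreal\<close> truncates negative arguments to 0, so the quotient
          is computed by sign.\<close>
        using elim by (cases "0 \<le> real N * ?b + ?d")
          (auto simp: divide_ennreal ennreal_of_nat_eq_real_of_nat ennreal_neg divide_nonpos_pos)
      also have "(real N * ?b + ?d) / real N = ?b + ?d / real N" using elim by (simp add: field_simps)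
      finally show ?case .
    qed
  qed
  also have "\<dots> = ennreal (?b + 0)"
  proof (rule lim_imp_Limsup)
    have "(\<lambda>N. ?d / real N) \<longlonglongrightarrow> 0" by (rule lim_const_over_n)
    then show "(\<lambda>N. ennreal (?b + ?d / real N)) \<longlonglongrightarrow> ennreal (?b + 0)"
      by (intro tendsto_ennrealI tendsto_add tendsto_const)
  qed simp
  finally show ?thesis by simp
qed

end

section \<open>Verification of the parameters and conclusion\<close>

theorem mainTheorem14:
  fixes M :: "'a measure" and D :: "real measure"
    and X Sz :: "nat \<Rightarrow> 'a \<Rightarrow> real"
    and lam m_minus m_plus c \<delta> m :: real
  assumes P: "prob_space M"
    and D: "prob_space D" "sets D = sets borel"
    and Dpos: "AE x in D. 0 < x"
    and Dcont: "\<And>x. measure D {x} = 0"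
    and D2: "integrable D (\<lambda>x. x ^ 2)"
    and lam: "0 < lam"
    and Xdist: "\<And>n. distributed M lborel (X n) (exponential_density lam)"
    and Sdist: "\<And>n. distr M borel (Sz n) = D"
    and Srv: "\<And>n. Sz n \<in> borel_measurable M"
    and indep: "prob_space.indep_vars M (\<lambda>_. borel)
                  (\<lambda>i. case i of Inl n \<Rightarrow> X n | Inr n \<Rightarrow> Sz n) UNIV"
    and m_bounds: "0 \<le> m_minus" "m_minus \<le> m_plus" "m_plus \<le> c"
    and alpha_pos: "1/2 - lam * (\<integral>x. x * indicator {..<m_minus} x \<partial>D) > 0"
    and beta_pos: "lam * (\<integral>x. x * indicator {..<m_minus} x \<partial>D)
                   + lam * (\<integral>x. x * indicator {m_minus..<m_plus} x \<partial>D) - 1/2 > 0"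
    and delta_pos: "0 < \<delta>"
    and delta_eps: "\<delta> \<le> 1 - lam * (\<integral>x. x \<partial>D)"
    and eps_half: "1 - lam * (\<integral>x. x \<partial>D) < 1/2"
    and beta_delta: "lam * (\<integral>x. x * indicator {..<m_minus} x \<partial>D)
                   + lam * (\<integral>x. x * indicator {m_minus..<m_plus} x \<partial>D) - 1/2 \<ge> 2 * \<delta>"
    and c_def: "c = 2 * m_plus / (lam * (\<integral>x. x * indicator {..<m_minus} x \<partial>D)
                   + lam * (\<integral>x. x * indicator {m_minus..<m_plus} x \<partial>D) - 1/2)
                 * ln (3 / (2 * (lam * (\<integral>x. x * indicator {..<m_minus} x \<partial>D)
                   + lam * (\<integral>x. x * indicator {m_minus..<m_plus} x \<partial>D) - 1/2) * \<delta>))"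
    and m_def: "(\<integral>x. x * indicator {..<m} x \<partial>D) = (\<integral>x. x \<partial>D) / 2"
  shows
    "let ES = (\<integral>x. x \<partial>D);
         \<rho> = lam * ES; \<epsilon> = 1 - \<rho>;
         \<rho>s = lam * (\<integral>x. x * indicator {..<m_minus} x \<partial>D);
         \<rho>m = lam * (\<integral>x. x * indicator {m_minus..<m_plus} x \<partial>D);
         \<alpha> = 1/2 - \<rho>s; \<beta> = \<rho>s + \<rho>m - 1/2;
         L = ln (3 / (2 * \<beta> * \<delta>));
         K = 2 * measure D {m..};
         EW = lam * (\<integral>x. x ^ 2 \<partial>D) / (2 * \<epsilon>)
     in mean_resp_CARD M X Sz m_minus m_plus c
        \<le> ennreal ((K + 4 * \<beta> / (\<alpha> + \<beta>)) * (1 + \<delta> / \<epsilon>) * EW + 2 * ES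
            + 44 * m_plus * max (\<beta> / (\<alpha>^2 * (\<alpha> + \<beta>)))
                (max (sqrt (\<beta> / (\<alpha>^2 * \<epsilon> * (\<alpha> + \<beta>))))
                 (max (L / (\<beta> * (\<alpha> + \<beta>)))
                  (max (sqrt (L / \<beta>))
                       (sqrt \<delta> * L / (\<alpha>^2 * \<beta>^2 * \<epsilon>))))))"
proof -
  interpret D: prob_space D by fact
  define \<alpha> where "\<alpha> = 1/2 - lam * (\<integral>x. x * indicator {..<m_minus} x \<partial>D)"
  define \<beta> where "\<beta> = lam * (\<integral>x. x * indicator {..<m_minus} x \<partial>D)
    + lam * (\<integral>x. x * indicator {m_minus..<m_plus} x \<partial>D) - 1/2"
  define \<epsilon> where "\<epsilon> = 1 - lam * (\<integral>x. x \<partial>D)"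
  define L where "L = ln (3 / (2 * \<beta> * \<delta>))"
  define K where "K = 2 * measure D {m..}"
  note [measurable_cong] = D(2)
  have int: "integrable D (\<lambda>x. x)"
    using D2 by (rule D.square_integrable_imp_integrable[rotated]) simp
  have int_on: "integrable D (\<lambda>x. x * indicator A x)" if [measurable]: "A \<in> sets borel" for A :: "real set"
    using int by (rule Bochner_Integration.integrable_bound) (auto simp: indicator_def)
  have on_nonneg: "0 \<le> (\<integral>x. x * indicator A x \<partial>D)" for A :: "real set"
    using Dpos by (intro integral_nonneg_AE) (auto elim: eventually_mono)
  have mono_on: "(\<integral>x. x * indicator A x \<partial>D) \<le> (\<integral>x. x * indicator B x \<partial>D)"
    if "A \<in> sets borel" "B \<in> sets borel" "A \<subseteq> B" for A B :: "real set"
  proof (rule integral_mono_AE[OF int_on[OF that(1)] int_on[OF that(2)]])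
    show "AE x in D. x * indicator A x \<le> x * indicator B x"
      using Dpos by eventually_elim (use that(3) in \<open>auto simp: indicator_def\<close>)
  qed
  have load_plus: "lam * (\<integral>x. x * indicator {..<m_plus} x \<partial>D) = 1/2 + \<beta>"
  proof -
    have "x * indicator {..<m_plus} x = x * indicator {..<m_minus} x + x * indicator {m_minus..<m_plus} x" for x
      using m_bounds by (auto simp: indicator_def)
    then show ?thesis using int_on by (simp add: \<beta>_def distrib_left)
  qed
  have \<alpha>: "0 < \<alpha>" "\<alpha> \<le> 1/2" using alpha_pos on_nonneg[of "{..<m_minus}"] lam by (auto simp: \<alpha>_def)
  have \<epsilon>: "\<delta> \<le> \<epsilon>" "0 < \<epsilon>" "\<epsilon> \<le> 1/2" using delta_eps delta_pos eps_half by (auto simp: \<epsilon>_def)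
  have \<beta>: "0 < \<beta>" "2 * \<delta> \<le> \<beta>" using beta_pos beta_delta by (auto simp: \<beta>_def)
  have "lam * (\<integral>x. x * indicator {..<m_plus} x \<partial>D) \<le> lam * (\<integral>x. x * indicator UNIV x \<partial>D)"
    using lam by (intro mult_left_mono mono_on) auto
  then have \<beta>': "\<beta> \<le> 1/2" using \<epsilon> load_plus by (simp add: \<epsilon>_def)
  \<comment> \<open>Otherwise almost no size lies below \<open>m_plus\<close>, and the load
    \<open>1/2 + \<beta>\<close> would vanish.\<close>
  have m_plus: "0 < m_plus"
  proof (rule ccontr)
    assume "\<not> 0 < m_plus"
    then have "(\<integral>x. x * indicator {..<m_plus} x \<partial>D) = (\<integral>x. 0 \<partial>D)"
      using Dpos int_on by (intro integral_cong_AE) (auto simp: indicator_def elim: eventually_mono)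
    then show False using load_plus \<beta> by simp
  qed
  interpret card_queue D lam m_minus m_plus c \<alpha> \<beta> \<epsilon> M X Sz
  proof (intro card_queue.intro card_drift.intro card_drift_axioms.intro card_queue_axioms.intro)
    show "lam * (\<integral>x. x * indicator {..<m_minus} x \<partial>D) = 1/2 - \<alpha>" by (simp add: \<alpha>_def)
    show "lam * (\<integral>x. x \<partial>D) = 1 - \<epsilon>" by (simp add: \<epsilon>_def)
  qed (use assms load_plus \<alpha> \<beta> \<beta>' \<epsilon> m_plus in auto)
  \<comment> \<open>Sizes below \<open>m\<close> carry load
    \<open>(1 - \<epsilon>) / 2 < 1/2\<close>, those below \<open>m_plus\<close> carry
    \<open>1/2 + \<beta>\<close>. Hence sizes of at least \<open>m_plus\<close> are covered by
    \<open>K\<close>.\<close>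
  have m_le: "m \<le> m_plus"
  proof (rule ccontr)
    assume "\<not> m \<le> m_plus"
    then have "lam * (\<integral>x. x * indicator {..<m_plus} x \<partial>D) \<le> lam * (\<integral>x. x * indicator {..<m} x \<partial>D)"
      using lam by (intro mult_left_mono mono_on) auto
    also have "\<dots> = (1 - \<epsilon>) / 2" by (simp add: m_def \<epsilon>_def)
    finally show False using load_plus \<beta> \<epsilon> by simp
  qed
  have K: "0 \<le> K" "K \<le> 2" "2 * measure D {m_plus..} \<le> K"
    using m_le by (auto simp: K_def intro!: D.finite_measure_mono)
  have bd: "\<beta> * \<delta> \<le> 1/8" "0 < \<beta> * \<delta>"
  proof -
    have "\<beta> * \<delta> \<le> 1/2 * (1/4)" using \<beta> \<beta>' delta_pos by (intro mult_mono) auto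
    then show "\<beta> * \<delta> \<le> 1/8" "0 < \<beta> * \<delta>" using \<beta> delta_pos by auto
  qed
  \<comment> \<open>\<open>\<beta> * \<delta> \<le> 1/8\<close> makes the argument of the logarithm
    at least 12, and \<open>exp 2 \<le> 9\<close>.\<close>
  have L: "2 \<le> L"
  proof -
    have "exp 2 = exp 1 * exp (1 :: real)" by (simp add: exp_add[symmetric])
    also have "\<dots> \<le> 3 * 3" using exp_le by (intro mult_mono) auto
    also have "\<dots> \<le> 3 / (2 * \<beta> * \<delta>)" using bd by (simp add: pos_le_divide_eq)
    finally show ?thesis using bd by (simp add: L_def ln_ge_iff mult.assoc)
  qed
  have c_eq: "c = 2 * m_plus / \<beta> * L" using c_def by (simp add: \<beta>_def L_def)
  define e where "e = exp (- \<theta> * c)"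
  have e: "e = (2 * \<beta> * \<delta> / 3)\<^sup>2"
  proof -
    \<comment> \<open>The factor 2 in the threshold becomes the square in \<open>e\<close>:
      \<open>\<theta> * c = 2 * L\<close>.\<close>
    have "- \<theta> * c = - L + - L" using m_plus \<beta> by (simp add: \<theta>_def c_eq)
    moreover have "exp (- L) = 2 * \<beta> * \<delta> / 3" using bd by (simp add: L_def exp_minus mult.assoc)
    ultimately show ?thesis unfolding e_def by (simp only: exp_add power2_eq_square)
  qed
  define s where "s = \<alpha> + \<beta>"
  have s: "0 < s" "s \<le> 1" "\<beta> \<le> s" using \<alpha> \<beta> \<beta>' by (auto simp: s_def)
  have e_le: "e \<le> \<beta> * \<delta> / 2"
  proof -
    have "\<beta> * \<delta> * (\<beta> * \<delta>) \<le> 1/8 * (\<beta> * \<delta>)" using bd by (intro mult_right_mono) auto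
    then show ?thesis using bd by (simp add: e power2_eq_square)
  qed
  have e1: "e < 1" using e_le bd by simp
  \<comment> \<open>This weight balances the two sides of Young's inequality: idle cost proportional
    to \<open>t2\<close>, overshoot cost proportional to \<open>\<beta> / (\<alpha>\<^sup>2 *
    \<epsilon> * (\<alpha> + \<beta>)) / t2\<close>.\<close>
  define t2 where "t2 = sqrt (\<beta> / (\<alpha>\<^sup>2 * \<epsilon> * (\<alpha> + \<beta>)))"
  have t2: "0 < t2" using \<alpha> \<beta> \<epsilon> by (simp add: t2_def)
  have W: "K + 2 * (\<beta> / (\<alpha> + \<beta>)) + ((\<alpha> + \<beta>) * ((K + 4 * (\<beta> / (\<alpha> + \<beta>))) * (1 + \<delta> / \<epsilon>)) + 2 * \<epsilon>) * e / \<epsilon>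
      \<le> (K + 4 * (\<beta> / (\<alpha> + \<beta>))) * (1 + \<delta> / \<epsilon>)"
  proof (rule linear_coefficient_le)
    have "\<beta> * \<delta> / 2 \<le> \<beta>" using \<epsilon> \<beta> by (simp add: mult_left_le)
    also have "\<beta> \<le> \<beta> / s" using s \<beta> by (simp add: pos_le_divide_eq mult_left_le)
    finally show "e \<le> \<beta> / (\<alpha> + \<beta>)" using e_le unfolding s_def by linarith
    have "e * s \<le> \<beta> * \<delta> / 2 * 1" using e_le s bd by (intro mult_mono) auto
    also have "\<dots> \<le> \<delta> / 2" using \<beta>' delta_pos by (simp add: mult_left_le_one_le \<beta>(1) less_imp_le)
    finally show "e * (\<alpha> + \<beta>) \<le> \<delta> / 2" by (simp add: s_def)
  qed (use K \<epsilon> delta_pos in \<open>auto simp: e\<close>)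
  obtain G dG C where G: "service_pair lam G dG"
    "\<And>a b. 0 \<le> a \<Longrightarrow> 0 \<le> b \<Longrightarrow> - C \<le> G a b"
    "\<And>a b. 0 \<le> a \<Longrightarrow> 0 \<le> b \<Longrightarrow> 2 * a + K * b + 2 * b * of_bool (c < a) + drift G dG a b
       \<le> (K + 4 * (\<beta> / (\<alpha> + \<beta>))) * (1 + \<delta> / \<epsilon>) * (lam * (\<integral>s. s\<^sup>2 \<partial>D) / (2 * \<epsilon>)) + lyapunov_bound K \<delta> t2 e"
    by (rule lyapunov_exists[OF K(1) delta_pos t2 e1[unfolded e_def] W[unfolded e_def], folded e_def]) (rule that)
  define Mx where "Mx = max (\<beta> / (\<alpha>^2 * (\<alpha> + \<beta>)))
                (max (sqrt (\<beta> / (\<alpha>^2 * \<epsilon> * (\<alpha> + \<beta>))))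
                 (max (L / (\<beta> * (\<alpha> + \<beta>)))
                  (max (sqrt (L / \<beta>))
                       (sqrt \<delta> * L / (\<alpha>^2 * \<beta>^2 * \<epsilon>)))))"
  have "lyapunov_bound K \<delta> t2 e \<le> m_plus * (44 * Mx)"
  proof -
    define H where "H = (K + 4 * (\<beta> / (\<alpha> + \<beta>))) * (1 + \<delta> / \<epsilon>) + 2 * \<epsilon> / (\<alpha> + \<beta>)"
    have "lyapunov_bound K \<delta> t2 e = m_plus * (2 / (\<alpha> + \<beta>) + (2 * L / \<beta> + 1 / \<beta> + t2 / 2) * H + 4 * L / \<beta>
      + ((1/2 + 3 / (8 * \<alpha>)) * (H / (12 * \<epsilon> * \<alpha> * t2)) + H * e * \<alpha> / (\<beta> * \<epsilon>)) * (\<beta> / (\<alpha> + \<beta>)) / (1 - e))"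
      unfolding lyapunov_bound_def Let_def H_def[symmetric] unfolding c_eq by (simp add: algebra_simps)
    also have "\<dots> \<le> m_plus * (44 * Mx)"
      unfolding t2_def H_def
      by (intro mult_left_mono constant_le) (use \<alpha> \<beta> \<beta>' \<epsilon> delta_pos K L e m_plus in \<open>auto simp: Mx_def\<close>)
    finally show ?thesis .
  qed
  then have ly: "lyapunov_bound K \<delta> t2 e \<le> 44 * m_plus * Mx" by simp
  have "mean_resp_CARD M X Sz m_minus m_plus c
    \<le> ennreal ((K + 4 * (\<beta> / (\<alpha> + \<beta>))) * (1 + \<delta> / \<epsilon>) * (lam * (\<integral>s. s\<^sup>2 \<partial>D) / (2 * \<epsilon>))
        + lyapunov_bound K \<delta> t2 e + 2 * (\<integral>x. x \<partial>D))"
    by (rule mean_resp_le[OF G K(3)])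
  also have "\<dots> \<le> ennreal ((K + 4 * (\<beta> / (\<alpha> + \<beta>))) * (1 + \<delta> / \<epsilon>) * (lam * (\<integral>s. s\<^sup>2 \<partial>D) / (2 * \<epsilon>))
        + 2 * (\<integral>x. x \<partial>D) + 44 * m_plus * Mx)"
    using ly by (intro ennreal_leI) linarith
  finally show ?thesis
    unfolding Let_def \<alpha>_def[symmetric] \<beta>_def[symmetric] \<epsilon>_def[symmetric] K_def[symmetric] L_def[symmetric]
      Mx_def[symmetric] by simp
qed

end
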